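(* For every $n\in\mathbb{N}$, every $P\in\mathcal{P}(\mathbb{C}^n)$ and every $0<p<\infty$, $$\|P\|_{L^p(\mathbb{T}^n)}\le\bigg(\prod_{j=1}^n\Lambda(p,d_j)\bigg)M(P),$$ where $d_j$ is the degree of $P$ in the $j$th variable, $d_j=\max\{\alpha_j : c_\alpha(P)\ne0\}$. Moreover, this inequality is sharp: for any $d_1,\dots,d_n\in\mathbb{N}$, the polynomial $$P(z_1,\dots,z_n)=\prod_{j=1}^n(1+z_j)^{d_j},\qquad (z_1,\dots,z_n)\in\mathbb{C}^n,$$ satisfies $\|P\|_{L^p(\mathbb{T}^n)}=\prod_{j=1}^n\Lambda(p,d_j)$ as well as $M(P)=1$.
   Context: $\mathcal{P}(\mathbb{C}^n)$ is the space of all polynomials $P(z)=\sum_\alpha c_\alpha(P)z^\alpha$ on $\mathbb{C}^n$ (finite sum over $\alpha\in\mathbb{N}_0^n$). The degree $d_j$ is read as $0$ for the zero polynomial. $\mathbb{T}^n=\{z\in\mathbb{C}^n:|z_1|=\dots=|z_n|=1\}$ carries the normalized Lebesgue (Haar probability) measure $dz$, and $\|P\|_{L^p(\mathbb{T}^n)}=\big(\int_{\mathbb{T}^n}|P|^p\,dz\big)^{1/p}$ for $0<p<\infty$. The Mahler measure of $P\neq 0$ is $M(P)=\exp\int_{\mathbb{T}^n}\log|P|\,dz$, and $M(0)=0$. For $0<p<\infty$ and $m\in\mathbb{N}_0$, $\Lambda(p,m)=\Big(\int_{\mathbb{T}}|1+z|^{mp}\,dz\Big)^{1/p}$. *)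

theory Defs
  imports "HOL-Analysis.Analysis" "HOL-Library.Poly_Mapping"
begin

text \<open>
  A polynomial is its finitely supported family of coefficients, indexed by finitely supported
  multi-indices; the variables \<open>z\<^sub>1, \<dots>, z\<^sub>n\<close> are numbered \<open>0, \<dots>, n - 1\<close>. The type carries the
  library's convolution product, i.e. the usual ring structure on polynomials.
\<close>

type_synonym multi_index = "nat \<Rightarrow>\<^sub>0 nat"
type_synonym cpoly = "multi_index \<Rightarrow>\<^sub>0 complex"

definition polys :: "nat \<Rightarrow> cpoly set" where
  "polys n = {P. \<forall>\<alpha>\<in>Poly_Mapping.keys P. Poly_Mapping.keys \<alpha> \<subseteq> {..<n}}"

definition poly_eval :: "nat \<Rightarrow> cpoly \<Rightarrow> (nat \<Rightarrow> complex) \<Rightarrow> complex" where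
  "poly_eval n P z =
     (\<Sum>\<alpha>\<in>Poly_Mapping.keys P. Poly_Mapping.lookup P \<alpha> * (\<Prod>j<n. z j ^ Poly_Mapping.lookup \<alpha> j))"

definition poly_var :: "nat \<Rightarrow> cpoly" where
  "poly_var j = Poly_Mapping.single (Poly_Mapping.single j 1) 1"

definition degree_in :: "nat \<Rightarrow> cpoly \<Rightarrow> nat" where
  "degree_in j P = Max (insert 0 ((\<lambda>\<alpha>. Poly_Mapping.lookup \<alpha> j) ` Poly_Mapping.keys P))"

definition circle_measure :: "complex measure" where
  "circle_measure =
     distr (uniform_measure lborel {0..2 * pi}) (restrict_space borel (sphere 0 1)) cis"

text \<open>The underlying space of the product measure is \<open>{..<n} \<rightarrow>\<^sub>E sphere 0 1\<close>.\<close>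

definition torus_measure :: "nat \<Rightarrow> (nat \<Rightarrow> complex) measure" where
  "torus_measure n = (\<Pi>\<^sub>M j\<in>{..<n}. circle_measure)"

definition torus_Lp_norm :: "nat \<Rightarrow> real \<Rightarrow> cpoly \<Rightarrow> real" where
  "torus_Lp_norm n p P = (\<integral>z. norm (poly_eval n P z) powr p \<partial>torus_measure n) powr (1 / p)"

text \<open>
  For a nonzero polynomial in \<open>n\<close> variables the integrand below is integrable and the zeros of
  the polynomial form a null set of the torus, so neither the value \<open>0\<close> of a divergent Bochner
  integral nor the convention \<open>ln 0 = 0\<close> affects the Mahler measure.
\<close>

definition mahler_measure :: "nat \<Rightarrow> cpoly \<Rightarrow> real" where
  "mahler_measure n P =
     (if P = 0 then 0 else exp (\<integral>z. ln (norm (poly_eval n P z)) \<partial>torus_measure n))"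

text \<open>
  For \<open>m = 0\<close> the integrand is \<open>0\<close> instead of \<open>1\<close> at the single point \<open>-1\<close>, since \<open>0 powr 0 = 0\<close>;
  the integral is unaffected.
\<close>

definition Lambda_const :: "real \<Rightarrow> nat \<Rightarrow> real" where
  "Lambda_const p m = (\<integral>z. norm (1 + z) powr (real m * p) \<partial>circle_measure) powr (1 / p)"

lemma poly_eval_superset:
  assumes "finite A" "Poly_Mapping.keys P \<subseteq> A"
  shows "poly_eval n P z =
    (\<Sum>\<alpha>\<in>A. Poly_Mapping.lookup P \<alpha> * (\<Prod>j<n. z j ^ Poly_Mapping.lookup \<alpha> j))"
  unfolding poly_eval_def using assms
  by (intro sum.mono_neutral_left) (auto simp: in_keys_iff)

lemma poly_eval_add: "poly_eval n (P + Q) z = poly_eval n P z + poly_eval n Q z"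
proof -
  let ?A = "Poly_Mapping.keys P \<union> Poly_Mapping.keys Q"
  have fin: "finite ?A" by simp
  have "poly_eval n (P + Q) z = (\<Sum>\<alpha>\<in>?A. Poly_Mapping.lookup (P + Q) \<alpha> * (\<Prod>j<n. z j ^ Poly_Mapping.lookup \<alpha> j))"
    by (rule poly_eval_superset[OF fin Poly_Mapping.keys_add])
  also have "\<dots> = poly_eval n P z + poly_eval n Q z"
    using poly_eval_superset[OF fin, of P n z] poly_eval_superset[OF fin, of Q n z]
    by (simp add: lookup_add distrib_right sum.distrib)
  finally show ?thesis .
qed

lemma poly_eval_zero [simp]: "poly_eval n 0 z = 0"
  by (simp add: poly_eval_def)

lemma poly_eval_single:
  "poly_eval n (Poly_Mapping.single \<alpha> c) z = c * (\<Prod>j<n. z j ^ Poly_Mapping.lookup \<alpha> j)"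
  by (cases "c = 0") (simp_all add: poly_eval_def)

lemma poly_eval_one [simp]: "poly_eval n 1 z = 1"
  using poly_eval_single[of n 0 1 z] by simp

lemma poly_eval_var: "j < n \<Longrightarrow> poly_eval n (poly_var j) z = z j"
  by (simp add: poly_var_def poly_eval_single lookup_single when_def if_distrib[of "\<lambda>k. z _ ^ k"]
      cong: if_cong)

lemma poly_mapping_add_single_induct [case_names zero add_single]:
  fixes P :: "'a \<Rightarrow>\<^sub>0 'b::comm_monoid_add"
  assumes "R 0" and step: "\<And>a b Q. R Q \<Longrightarrow> R (Poly_Mapping.single a b + Q)"
  shows "R P"
proof (induction P rule: update_induct)
  case const
  show ?case by (fact assms(1))
next
  case (update f a b)
  have "Poly_Mapping.update a b f = Poly_Mapping.single a b + f"
    using update(1) by (intro poly_mapping_eqI)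
      (auto simp: lookup_update lookup_add lookup_single when_def in_keys_iff)
  then show ?case using step update by metis
qed

lemma poly_eval_mult: "poly_eval n (P * Q) z = poly_eval n P z * poly_eval n Q z"
proof -
  have single: "poly_eval n (Poly_Mapping.single \<alpha> c * Poly_Mapping.single \<beta> d) z =
      poly_eval n (Poly_Mapping.single \<alpha> c) z * poly_eval n (Poly_Mapping.single \<beta> d) z"
    for \<alpha> \<beta> c d
    by (simp add: mult_single poly_eval_single lookup_add power_add prod.distrib)
  have one: "poly_eval n (Poly_Mapping.single \<alpha> c * Q) z =
      poly_eval n (Poly_Mapping.single \<alpha> c) z * poly_eval n Q z" for \<alpha> c
    by (induction Q rule: poly_mapping_add_single_induct)
      (simp_all add: single distrib_left poly_eval_add)
  show ?thesis
    by (induction P rule: poly_mapping_add_single_induct)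
      (simp_all add: one distrib_right poly_eval_add)
qed

lemma poly_eval_power: "poly_eval n (P ^ k) z = poly_eval n P z ^ k"
  by (induction k) (simp_all add: poly_eval_mult)

lemma poly_eval_prod: "poly_eval n (\<Prod>i\<in>I. f i) z = (\<Prod>i\<in>I. poly_eval n (f i) z)"
  by (induction I rule: infinite_finite_induct) (simp_all add: poly_eval_mult)

lemma poly_eval_extremal:
  "poly_eval n (\<Prod>j<n. (1 + poly_var j) ^ d j) z = (\<Prod>j<n. (1 + z j) ^ d j)"
  by (simp add: poly_eval_prod poly_eval_power poly_eval_add poly_eval_var)

end

theory Submission
  imports
    Defs
    "HOL-Probability.Probability"
    "HOL-Complex_Analysis.Complex_Analysis"
    "HOL-Computational_Algebra.Fundamental_Theorem_Algebra"
begin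

text \<open>
  In one variable, factor the polynomial into linear factors. On the unit circle
  \<open>\<bar>z - \<alpha>\<bar> = max 1 \<bar>\<alpha>\<bar> * \<bar>1 - \<beta> z\<bar>\<close> with \<open>\<bar>\<beta>\<bar> \<le> 1\<close>, so the modulus of a polynomial of degree at most \<open>D\<close>
  is \<open>C * (\<Prod>i<D. \<bar>1 - \<beta>\<^sub>i z\<bar>)\<close>. Each \<open>ln \<bar>1 - \<beta> z\<bar>\<close> has mean \<open>0\<close>, so \<open>C\<close> is the Mahler measure; by the
  inequality of arithmetic and geometric means the \<open>p\<close>-th power mean is at most the average of
  the integrals of \<open>C\<^sup>p * \<bar>1 - \<beta>\<^sub>i z\<bar>\<^bsup>Dp\<^esup>\<close>, and each of these is largest for \<open>\<bar>\<beta>\<^sub>i\<bar> = 1\<close> by the maximum principle.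

  Several variables follow by induction: the bounds in the last variable and in the remaining
  ones are combined by Jensen's inequality. Integrability of \<open>ln \<bar>P\<bar>\<close> comes from
  the one-variable bound of the logarithmic mean from below by the logarithm of the leading
  coefficient, which is a polynomial in fewer variables.
\<close>

section \<open>The circle measure\<close>

lemma space_circle_measure [simp]: "space circle_measure = sphere 0 1"
  by (simp add: circle_measure_def space_restrict_space)

lemma sets_circle_measure [measurable_cong]:
  "sets circle_measure = sets (restrict_space borel (sphere 0 1))"
  by (simp add: circle_measure_def)

lemma measurable_cis_circle:
  "cis \<in> uniform_measure lborel {0..2 * pi} \<rightarrow>\<^sub>M restrict_space borel (sphere 0 1)"
  by (intro measurable_restrict_space2)
    (auto intro!: borel_measurable_continuous_onI continuous_intros
      simp: measurable_cong_sets[OF sets_uniform_measure refl])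

lemma prob_space_circle_measure: "prob_space circle_measure"
  unfolding circle_measure_def
  by (intro prob_space.prob_space_distr prob_space_uniform_measure measurable_cis_circle) auto

interpretation circle: prob_space circle_measure
  by (rule prob_space_circle_measure)

lemma measure_circle_sphere [simp]: "measure circle_measure (sphere 0 1) = 1"
  using circle.prob_space by simp

lemma measurable_circle_ident [measurable]: "(\<lambda>z. z) \<in> circle_measure \<rightarrow>\<^sub>M borel"
  unfolding circle_measure_def by (simp add: measurable_restrict_space1)

lemma borel_measurable_circle:
  "f \<in> borel_measurable borel \<Longrightarrow> f \<in> borel_measurable circle_measure"
  using measurable_compose[OF measurable_circle_ident] by simp

text \<open>The circle measure is the image under \<open>cis\<close> of density 1/(2 pi) on
  [0, 2 pi]. This passes to the gauge integral, for which shifts of the interval and differentiation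
  under the integral sign are available.\<close>

lemma integral_circle_continuous:
  fixes f :: "complex \<Rightarrow> 'a::euclidean_space"
  assumes "continuous_on (sphere 0 1) f"
  shows "(\<integral>z. f z \<partial>circle_measure) = (1 / (2 * pi)) *\<^sub>R integral {0..2 * pi} (\<lambda>t. f (cis t))"
proof -
  have f: "f \<in> borel_measurable (restrict_space borel (sphere 0 1))"
    using assms by (intro borel_measurable_continuous_on_restrict)
  have c: "continuous_on {0..2*pi} (\<lambda>t. f (cis t))"
    by (rule continuous_on_compose2[OF assms]) (auto intro!: continuous_intros)
  have i: "set_integrable lborel {0..2*pi} (\<lambda>t. f (cis t))"
    using c by (intro borel_integrable_atLeastAtMost') auto
  have "(\<integral>z. f z \<partial>circle_measure) = (\<integral>t. f (cis t) \<partial>uniform_measure lborel {0..2 * pi})"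
    unfolding circle_measure_def by (intro integral_distr measurable_cis_circle f)
  also have "\<dots> = (\<integral>t. (1/(2*pi)) *\<^sub>R (indicator {0..2*pi} t *\<^sub>R f (cis t)) \<partial>lborel)"
  proof -
    have "uniform_measure lborel {0..2 * pi} = density lborel (\<lambda>t. ennreal (indicator {0..2*pi} t / (2*pi)))"
      unfolding uniform_measure_def
      by (intro density_cong) (auto simp: indicator_def divide_ennreal ennreal_1[symmetric] simp del: ennreal_1)
    moreover have "(\<integral>t. f (cis t) \<partial>density lborel (\<lambda>t. ennreal (indicator {0..2*pi} t / (2*pi)))) = 
       (\<integral>t. (indicator {0..2*pi} t / (2*pi)) *\<^sub>R f (cis t) \<partial>lborel)"
      using measurable_comp[OF measurable_cis_circle f] 
      by (intro integral_density) (auto simp: comp_def)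
    ultimately show ?thesis by simp
  qed
  also have "\<dots> = (1 / (2 * pi)) *\<^sub>R set_lebesgue_integral lborel {0..2*pi} (\<lambda>t. f (cis t))"
    unfolding set_lebesgue_integral_def by (rule integral_scaleR_right)
  also have "set_lebesgue_integral lborel {0..2*pi} (\<lambda>t. f (cis t)) = integral {0..2*pi} (\<lambda>t. f (cis t))"
    using i by (rule set_borel_integral_eq_integral)
  finally show ?thesis .
qed

lemma integrable_circle_continuous:
  fixes f :: "complex \<Rightarrow> 'a::euclidean_space"
  assumes "continuous_on (sphere 0 1) f"
  shows "integrable circle_measure f"
proof -
  have f: "f \<in> borel_measurable circle_measure"
    using borel_measurable_continuous_on_restrict[OF assms] by (simp add: circle_measure_def)
  have "bounded (f ` sphere 0 1)"
    by (intro compact_imp_bounded compact_continuous_image assms) auto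
  then obtain B where "\<And>z. z \<in> sphere 0 1 \<Longrightarrow> norm (f z) \<le> B"
    unfolding bounded_iff by blast
  then show ?thesis
    using f by (intro circle.integrable_const_bound[where B=B]) auto
qed

text \<open>Each fibre lies in a translate of 2 pi times the integers. Hence single points of the
  circle are null, so finitely many zeros can be ignored.\<close>

lemma countable_cis_eq: "countable {t. cis t = c}"
proof (cases "\<exists>t. cis t = c")
  case True
  then obtain t0 where t0: "cis t0 = c" ..
  have "{t. cis t = c} \<subseteq> range (\<lambda>n::int. t0 + 2 * pi * n)"
  proof
    fix t assume "t \<in> {t. cis t = c}"
    then have "sin t = sin t0 \<and> cos t = cos t0"
      using t0 by (auto simp: complex_eq_iff)
    then show "t \<in> range (\<lambda>n::int. t0 + 2 * pi * n)"
      unfolding sin_cos_eq_iff by auto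
  qed
  then show ?thesis
    by (rule countable_subset) simp
qed simp

lemma AE_circle_neq: "AE z in circle_measure. z \<noteq> c"
proof -
  have "AE t in lborel. cis t \<noteq> c"
    using AE_not_in[OF countable_imp_null_set_lborel[OF countable_cis_eq[of c]]] by simp
  then have "AE t in uniform_measure lborel {0..2*pi}. cis t \<noteq> c"
    by (intro AE_uniform_measureI) auto
  moreover have "{z \<in> space (restrict_space borel (sphere 0 1)). z \<noteq> c} \<in> sets (restrict_space borel (sphere 0 1))"
    by (auto simp: sets_restrict_space space_restrict_space intro!: image_eqI[where x="- {c}"])
  ultimately show ?thesis
    unfolding circle_measure_def by (subst AE_distr_iff[OF measurable_cis_circle]) auto
qed

text \<open>Rotation by \<open>c\<close> shifts the angle by its argument \<open>s\<close>. The part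
  of the shifted interval beyond 2 pi is folded back to [0, s] by periodicity.\<close>

lemma integral_circle_rotate:
  fixes f :: "complex \<Rightarrow> 'a::euclidean_space"
  assumes f: "continuous_on (sphere 0 1) f" and c: "norm c = 1"
  shows "(\<integral>z. f (c * z) \<partial>circle_measure) = (\<integral>z. f z \<partial>circle_measure)"
proof -
  define s where "s = Arg2pi c"
  have s: "0 \<le> s" "s \<le> 2 * pi" "c = cis s"
    using Arg2pi[of c] c by (auto simp: s_def cis_conv_exp is_Arg_def)
  define F where "F = (\<lambda>t. f (cis t))"
  have F: "F integrable_on {a..b}" for a b
    unfolding F_def
    by (intro integrable_continuous_real continuous_on_compose2[OF f]) (auto intro!: continuous_intros)
  have per: "F (2 * pi + t) = F t" for t
    by (simp add: F_def flip: cis_mult)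
  have "integral {0..2 * pi} (\<lambda>t. f (c * cis t)) = integral {0..2*pi} (F \<circ> (+) s)"
    by (simp add: F_def s(3) cis_mult o_def)
  also have "\<dots> = integral {s..2*pi+s} F"
    by (simp add: integral_shift_Icc_real)
  also have "\<dots> = integral {s..2*pi} F + integral {2*pi..2*pi+s} F"
    by (rule Henstock_Kurzweil_Integration.integral_combine[symmetric]) (use s F in auto)
  also have "integral {2*pi..2*pi+s} F = integral {0..s} (F \<circ> (+) (2*pi))"
    by (simp add: integral_shift_Icc_real add.commute)
  also have "\<dots> = integral {0..s} F"
    by (simp add: o_def per)
  also have "integral {s..2*pi} F + integral {0..s} F = integral {0..2*pi} F"
    using Henstock_Kurzweil_Integration.integral_combine[of 0 s "2*pi" F] s F by (simp add: add.commute)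
  finally have *: "integral {0..2 * pi} (\<lambda>t. f (c * cis t)) = integral {0..2 * pi} (\<lambda>t. f (cis t))"
    by (simp add: F_def)
  have "continuous_on (sphere 0 1) (\<lambda>z. f (c * z))"
    by (intro continuous_on_compose2[OF f]) (auto intro!: continuous_intros simp: norm_mult c)
  then show ?thesis
    using f * by (simp add: integral_circle_continuous)
qed

text \<open>Differentiation under the integral sign in \<open>w\<close>: the
  \<open>w\<close>-derivative of the integrand is jointly continuous in \<open>w\<close> and the
  angle. The weight \<open>u\<close> need only be continuous, which allows conjugate phases.\<close>

lemma holomorphic_circle_integral:
  assumes h: "h holomorphic_on ball 0 1" and u: "continuous_on (sphere 0 1) u"
  shows "(\<lambda>w. \<integral>z. u z * h (w * z) \<partial>circle_measure) holomorphic_on ball 0 1"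
proof -
  have h': "continuous_on (ball 0 1) h" "continuous_on (ball 0 1) (deriv h)"
    using h by (auto intro!: holomorphic_on_imp_continuous_on holomorphic_deriv)
  have u': "continuous_on A (\<lambda>t. u (cis t))" for A
    by (intro continuous_on_compose2[OF u]) (auto intro!: continuous_intros)
  have m: "w * cis t \<in> ball 0 1" if "w \<in> ball 0 1" for w t
    using that by (simp add: norm_mult)
  have "(\<lambda>w. integral (cbox 0 (2*pi)) (\<lambda>t. u (cis t) * h (w * cis t))) holomorphic_on ball 0 1"
  proof (rule leibniz_rule_holomorphic)
    show "((\<lambda>w. u (cis t) * h (w * cis t)) has_field_derivative u (cis t) * (deriv h (w * cis t) * cis t))
       (at w within ball 0 1)" if "w \<in> ball 0 1" for w t
    proof -
      have "(h has_field_derivative deriv h (w * cis t)) (at (w * cis t))"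
        using holomorphic_derivI[OF h open_ball m[OF that]] .
      moreover have "((\<lambda>w. w * cis t) has_field_derivative cis t) (at w within ball 0 1)"
        by (auto intro!: derivative_eq_intros)
      ultimately have "((\<lambda>w. h (w * cis t)) has_field_derivative deriv h (w * cis t) * cis t) (at w within ball 0 1)"
        by (rule DERIV_chain2)
      then show ?thesis by (rule DERIV_cmult)
    qed
    show "(\<lambda>t. u (cis t) * h (w * cis t)) integrable_on cbox 0 (2 * pi)" if "w \<in> ball 0 1" for w
      unfolding cbox_interval
      by (intro integrable_continuous_real continuous_on_mult u' continuous_on_compose2[OF h'(1)])
        (use m[OF that] in \<open>auto intro!: continuous_intros\<close>)
    show "continuous_on (ball 0 1 \<times> cbox 0 (2 * pi))
       (\<lambda>(w, t). u (cis t) * (deriv h (w * cis t) * cis t))"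
      unfolding case_prod_unfold
      by (intro continuous_on_mult continuous_on_compose2[OF u] continuous_on_compose2[OF h'(2)])
        (use m in \<open>auto intro!: continuous_intros\<close>)
  qed (rule convex_ball)
  then have "(\<lambda>w. (1 / (2 * pi)) *\<^sub>R integral {0..2*pi} (\<lambda>t. u (cis t) * h (w * cis t))) holomorphic_on ball 0 1"
    unfolding scaleR_conv_of_real by (intro holomorphic_intros) (simp add: cbox_interval)
  moreover have "(\<integral>z. u z * h (w * z) \<partial>circle_measure) =
      (1 / (2 * pi)) *\<^sub>R integral {0..2*pi} (\<lambda>t. u (cis t) * h (w * cis t))" if "w \<in> ball 0 1" for w
    using that
    by (intro integral_circle_continuous continuous_on_mult u continuous_on_compose2[OF h'(1)])
      (auto intro!: continuous_intros simp: norm_mult)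
  ultimately show ?thesis
    by (subst holomorphic_cong[OF refl]) auto
qed

section \<open>The maximum principle and the logarithmic mean of a linear factor\<close>

lemma maximum_modulus_ball:
  fixes f :: "complex \<Rightarrow> complex"
  assumes f: "f holomorphic_on ball 0 R" and r: "0 < r" "r < R" and w: "norm w \<le> r"
    and le: "\<And>v. norm v = r \<Longrightarrow> norm (f v) \<le> B"
  shows "norm (f w) \<le> B"
proof (rule maximum_modulus_frontier[of f "cball 0 r"])
  show "f holomorphic_on interior (cball 0 r)"
    using r by (auto intro: holomorphic_on_subset[OF f])
  show "continuous_on (closure (cball 0 r)) f"
    using r by (auto intro: continuous_on_subset[OF holomorphic_on_imp_continuous_on[OF f]])
qed (use r w le in auto)

lemma one_minus_in_slit: "norm w < 1 \<Longrightarrow> 1 - w \<notin> \<real>\<^sub>\<le>\<^sub>0" for w :: complex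
  using complex_Re_le_cmod[of w] by (auto simp: complex_nonpos_Reals_iff)

lemma holomorphic_Ln_one_minus: "(\<lambda>w. Ln (1 - w)) holomorphic_on ball 0 1"
  by (intro holomorphic_intros one_minus_in_slit) auto

text \<open>By rotation invariance the holomorphic mean \<open>H\<close> takes the value
  \<open>H b\<close> on the whole circle of radius |b|. The maximum principle applied to
  \<open>H - H b\<close> then gives \<open>H b = H 0 = 0\<close>, and the claim is the real part of
  this.\<close>

lemma integral_ln_one_minus_inside:
  assumes b: "norm b < 1"
  shows "(\<integral>z. ln (norm (1 - b * z)) \<partial>circle_measure) = 0"
proof (cases "b = 0")
  case False
  define H where "H = (\<lambda>w. \<integral>z. Ln (1 - w * z) \<partial>circle_measure)"
  have cont: "continuous_on (sphere 0 1) (\<lambda>z. Ln (1 - w * z))" if "norm w < 1" for w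
    using one_minus_in_slit that by (intro continuous_intros ballI) (auto simp: norm_mult)
  have H: "H holomorphic_on ball 0 1"
    using holomorphic_circle_integral[OF holomorphic_Ln_one_minus, of "\<lambda>_. 1"] by (simp add: H_def)
  have "norm (H 0 - H b) \<le> 0"
  proof (rule maximum_modulus_ball[of "\<lambda>w. H w - H b" 1 "norm b"])
    fix v :: complex assume v: "norm v = norm b"
    have "H v = (\<integral>z. Ln (1 - b * (v / b * z)) \<partial>circle_measure)"
      using False by (simp add: H_def)
    also have "\<dots> = H b"
      unfolding H_def
      using v False by (intro integral_circle_rotate cont b) (simp add: norm_divide)
    finally show "norm (H v - H b) \<le> 0" by simp
  qed (use False b H in \<open>auto intro!: holomorphic_intros\<close>)
  then have "H b = 0" by (simp add: H_def)
  moreover have "Re (H b) = (\<integral>z. Re (Ln (1 - b * z)) \<partial>circle_measure)"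
    unfolding H_def by (rule integral_Re[symmetric]) (intro integrable_circle_continuous cont b)
  moreover have "\<dots> = (\<integral>z. ln (norm (1 - b * z)) \<partial>circle_measure)"
  proof (intro Bochner_Integration.integral_cong refl)
    fix z assume "z \<in> space circle_measure"
    then have "1 - b * z \<noteq> 0"
      using one_minus_in_slit[of "b * z"] b by (auto simp: norm_mult)
    then show "Re (Ln (1 - b * z)) = ln (norm (1 - b * z))" by simp
  qed
  ultimately show ?thesis by simp
qed simp

text \<open>The difference of the two sides is exactly (1 - r)^2. Taking logarithms, ln |1 -
  \<zeta>| exceeds ln |1 - r \<zeta>| by at most -(ln r)/2, a bound uniform in \<zeta> that tends to
  0 as r tends to 1.\<close>

lemma norm_one_minus_scale:
  fixes \<zeta> :: complex
  assumes "norm \<zeta> = 1" "0 \<le> r"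
  shows "r * norm (1 - \<zeta>) ^ 2 \<le> norm (1 - of_real r * \<zeta>) ^ 2"
proof -
  have "Re \<zeta> ^ 2 + Im \<zeta> ^ 2 = 1"
    using assms by (simp flip: cmod_power2)
  then have "norm (1 - of_real r * \<zeta>) ^ 2 - r * norm (1 - \<zeta>) ^ 2 = (1 - r) ^ 2"
    unfolding cmod_power2 by simp algebra
  then show ?thesis
    by (smt (verit) zero_le_power2)
qed

lemma borel_measurable_circle_ln [measurable]: 
  "(\<lambda>z. ln (norm (1 - b * z))) \<in> borel_measurable circle_measure"
  by (intro borel_measurable_circle) measurable

text \<open>
  On the boundary \<open>\<bar>b\<bar> = 1\<close>, radial approximation gives integrability and \<open>\<ge> 0\<close> by Fatou's lemma, and
  \<open>\<le> 0\<close> from the pointwise bound \<open>norm_one_minus_scale\<close>.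
\<close>

lemma
  assumes b: "norm b \<le> 1"
  shows integrable_ln_one_minus: "integrable circle_measure (\<lambda>z. ln (norm (1 - b * z)))"
    and integral_ln_one_minus: "(\<integral>z. ln (norm (1 - b * z)) \<partial>circle_measure) = 0"
proof -
  define l where "l = (\<lambda>b z::complex. ln (norm (1 - b * z)))"
  have inside: "integrable circle_measure (l b)" "integral\<^sup>L circle_measure (l b) = 0" if "norm b < 1" for b
  proof -
    have "1 - b * z \<noteq> 0" if "norm z = 1" for z
      using \<open>norm b < 1\<close> that one_minus_in_slit[of "b * z"] by (auto simp: norm_mult)
    then show "integrable circle_measure (l b)"
      unfolding l_def by (intro integrable_circle_continuous continuous_intros) auto
    show "integral\<^sup>L circle_measure (l b) = 0"
      using integral_ln_one_minus_inside[OF that] by (simp add: l_def)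
  qed
  have "integrable circle_measure (l b) \<and> integral\<^sup>L circle_measure (l b) = 0"
  proof (cases "norm b < 1")
    case False
    then have nb: "norm b = 1" using b by simp
    \<comment> \<open>The radii are 1 - 1/(n + 2); the offset keeps \<open>r 0\<close> positive, so
      that \<open>ln (r n)\<close> is meaningful for every \<open>n\<close>.\<close>
    define r :: "nat \<Rightarrow> real" where "r n = 1 - inverse (real (Suc n) + 1)" for n
    have r: "0 < r n" "r n < 1" for n
      by (auto simp: r_def field_simps)
    have rlim: "r \<longlonglongrightarrow> 1"
      unfolding r_def by real_asymp
    have nr: "norm (of_real (r n) * b) < 1" for n
      using r[of n] by (simp add: norm_mult nb)
    \<comment> \<open>This makes \<open>ln 2 - l b z\<close> nonnegative, as Fatou's lemma requires.
      At a zero of \<open>1 - b * z\<close> the bound holds through the convention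
      \<open>ln 0 = 0\<close>.\<close>
    have le2: "l b z \<le> ln 2" if "norm b \<le> 1" "norm z = 1" for b z
    proof (cases "1 - b * z = 0")
      case False
      have "norm (1 - b * z) \<le> 2"
        using norm_triangle_ineq4[of 1 "b * z"] that by (simp add: norm_mult)
      then show ?thesis using False by (simp add: l_def ln_le_cancel_iff)
    qed (simp add: l_def)
    have ne: "AE z in circle_measure. 1 - b * z \<noteq> 0"
      using AE_circle_neq[of "inverse b"] 
      by eventually_elim (use inverse_unique[of b] in auto)
    have [measurable]: "l b \<in> borel_measurable circle_measure" for b
      unfolding l_def by measurable
    have "(\<integral>\<^sup>+z. ennreal (ln 2 - l b z) \<partial>circle_measure) =
       (\<integral>\<^sup>+z. liminf (\<lambda>n. ennreal (ln 2 - l (of_real (r n) * b) z)) \<partial>circle_measure)"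
    proof (rule nn_integral_cong_AE, use ne in eventually_elim)
      fix z assume z: "1 - b * z \<noteq> 0"
      have "(\<lambda>n. l (of_real (r n) * b) z) \<longlonglongrightarrow> ln (norm (1 - of_real 1 * b * z))"
        unfolding l_def by (intro tendsto_intros rlim) (use z in auto)
      then have "(\<lambda>n. ennreal (ln 2 - l (of_real (r n) * b) z)) \<longlonglongrightarrow> ennreal (ln 2 - l b z)"
        by (intro tendsto_intros) (simp add: l_def)
      then show "ennreal (ln 2 - l b z) = liminf (\<lambda>n. ennreal (ln 2 - l (of_real (r n) * b) z))"
        by (intro lim_imp_Liminf[symmetric]) auto
    qed
    also have "\<dots> \<le> liminf (\<lambda>n. \<integral>\<^sup>+z. ennreal (ln 2 - l (of_real (r n) * b) z) \<partial>circle_measure)"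
      by (intro nn_integral_liminf) measurable
    also have "(\<lambda>n. \<integral>\<^sup>+z. ennreal (ln 2 - l (of_real (r n) * b) z) \<partial>circle_measure) = (\<lambda>_. ennreal (ln 2))"
    proof
      fix n
      have "(\<integral>\<^sup>+z. ennreal (ln 2 - l (of_real (r n) * b) z) \<partial>circle_measure) =
          ennreal (\<integral>z. ln 2 - l (of_real (r n) * b) z \<partial>circle_measure)"
        using inside(1)[OF nr] le2[of "of_real (r n) * b"] nr[of n]
        by (intro nn_integral_eq_integral) auto
      also have "\<dots> = ennreal (ln 2)"
        using inside[OF nr] by (simp add: circle.prob_space)
      finally show "(\<integral>\<^sup>+z. ennreal (ln 2 - l (of_real (r n) * b) z) \<partial>circle_measure) = ennreal (ln 2)" .
    qed
    finally have fatou: "(\<integral>\<^sup>+z. ennreal (ln 2 - l b z) \<partial>circle_measure) \<le> ennreal (ln 2)"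
      by (simp add: Liminf_const)
    have int2: "integrable circle_measure (\<lambda>z. ln 2 - l b z)"
      using fatou le2[OF b] by (intro integrableI_nonneg) (auto simp: top_unique intro: le_less_trans)
    have int: "integrable circle_measure (l b)"
      using Bochner_Integration.integrable_diff[OF circle.integrable_const[of "ln 2"] int2] by simp
    have "ennreal (\<integral>z. ln 2 - l b z \<partial>circle_measure) \<le> ennreal (ln 2)"
      using fatou int2 le2[OF b] by (subst nn_integral_eq_integral[symmetric]) auto
    then have lower: "0 \<le> integral\<^sup>L circle_measure (l b)"
      using int by (simp add: circle.prob_space ennreal_le_iff)
    have upper: "integral\<^sup>L circle_measure (l b) \<le> - ln (r n) / 2" for n
    proof -
      have "integral\<^sup>L circle_measure (l b) \<le> (\<integral>z. l (of_real (r n) * b) z - ln (r n) / 2 \<partial>circle_measure)"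
      proof (rule integral_mono_AE)
        show "AE z in circle_measure. l b z \<le> l (of_real (r n) * b) z - ln (r n) / 2"
          using ne AE_space
        proof eventually_elim
          fix z assume z: "1 - b * z \<noteq> 0" "z \<in> space circle_measure"
          have "r n * norm (1 - b * z) ^ 2 \<le> norm (1 - of_real (r n) * (b * z)) ^ 2"
            using r[of n] z nb by (intro norm_one_minus_scale) (auto simp: norm_mult)
          moreover have "0 < r n * norm (1 - b * z) ^ 2"
            using z r[of n] by simp
          ultimately have "ln (r n * norm (1 - b * z) ^ 2) \<le> ln (norm (1 - of_real (r n) * (b * z)) ^ 2)"
            by (subst ln_le_cancel_iff) auto
          moreover have "0 < norm (1 - of_real (r n) * (b * z))"
            using \<open>r n * _ \<le> _\<close> \<open>0 < r n * _\<close> by (cases "norm (1 - of_real (r n) * (b * z)) = 0") auto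
          ultimately show "l b z \<le> l (of_real (r n) * b) z - ln (r n) / 2"
            using z r[of n] by (simp add: l_def ln_mult ln_realpow mult.assoc)
        qed
      qed (use int inside(1)[OF nr] in auto)
      also have "\<dots> = - ln (r n) / 2"
        using inside[OF nr] by (simp add: circle.prob_space)
      finally show ?thesis .
    qed
    have "(\<lambda>n. - ln (r n) / 2) \<longlonglongrightarrow> - ln 1 / 2"
      by (intro tendsto_intros rlim) auto
    then have "integral\<^sup>L circle_measure (l b) \<le> 0"
      using upper by (intro LIMSEQ_le_const[where X = "\<lambda>n. - ln (r n) / 2"]) auto
    then show ?thesis using lower int by simp
  qed (use inside in auto)
  then show "integrable circle_measure (\<lambda>z. ln (norm (1 - b * z)))"
    "(\<integral>z. ln (norm (1 - b * z)) \<partial>circle_measure) = 0"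
    by (simp_all add: l_def)
qed

section \<open>Power means of a linear factor\<close>

lemma continuous_norm_powr [continuous_intros]:
  assumes "continuous_on A f" "q > 0"
  shows "continuous_on A (\<lambda>x. norm (f x) powr q)"
  using assms by (intro continuous_on_powr' continuous_intros) auto

text \<open>
  With \<open>u\<close> the conjugate phase of \<open>(1 - b z)\<^sup>q\<close>, the function \<open>w \<mapsto> \<integral> u(z) (1 - w z)\<^sup>q dz\<close> is
  holomorphic, equals the left-hand side at \<open>w = b\<close>, and is bounded by the (rotation invariant)
  right-hand side on \<open>\<bar>w\<bar> = \<rho>\<close>; so the maximum principle applies.
\<close>

lemma integral_powr_le_inside:
  fixes q :: real
  assumes b: "norm b < \<rho>" "\<rho> < 1" and q: "q > 0"
  shows "(\<integral>z. norm (1 - b * z) powr q \<partial>circle_measure) \<le> (\<integral>z. norm (1 + of_real \<rho> * z) powr q \<partial>circle_measure)"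
proof -
  define h where "h = (\<lambda>w::complex. (1 - w) powr of_real q)"
  define u where "u = (\<lambda>z. cnj (sgn (h (b * z))))"
  define G where "G = (\<lambda>w. \<integral>z. u z * h (w * z) \<partial>circle_measure)"
  have \<rho>: "0 < \<rho>" using b norm_ge_zero[of b] by linarith
  have nz: "1 - w \<noteq> 0" if "norm w < 1" for w :: complex
    using one_minus_in_slit[OF that] by auto
  have norm_h: "norm (h w) = norm (1 - w) powr q" if "norm w < 1" for w
    unfolding h_def using nz[OF that] by (subst norm_powr_real_powr') auto
  have holh: "h holomorphic_on ball 0 1"
    unfolding h_def by (intro holomorphic_intros one_minus_in_slit) auto
  have conth: "continuous_on (sphere 0 1) (\<lambda>z. h (w * z))" if "norm w < 1" for w
    by (intro continuous_on_compose2[OF holomorphic_on_imp_continuous_on[OF holh]])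
      (use that in \<open>auto intro!: continuous_intros simp: norm_mult\<close>)
  have hnz: "h (w * z) \<noteq> 0" if "norm w < 1" "norm z = 1" for w z
    using nz[of "w * z"] that by (simp add: h_def norm_mult)
  have contu: "continuous_on (sphere 0 1) u"
    unfolding u_def using b hnz by (intro continuous_intros conth) auto
  have nu: "norm (u z) = 1" if "norm z = 1" for z
    unfolding u_def using that b hnz by (auto simp: norm_sgn)
  have G: "G holomorphic_on ball 0 1"
    unfolding G_def by (intro holomorphic_circle_integral holh contu)
  have uh: "u z * h (b * z) = of_real (norm (1 - b * z) powr q)" if "norm z = 1" for z
  proof -
    have "u z * h (b * z) = of_real (norm (h (b * z)))"
      using hnz[of b z] b that complex_norm_square[of "h (b * z)"]
      by (simp add: u_def sgn_div_norm scaleR_conv_of_real field_simps power2_eq_square)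
    then show ?thesis
      using b that by (simp add: norm_h norm_mult)
  qed
  have "G b = (\<integral>z. of_real (norm (1 - b * z) powr q) \<partial>circle_measure)"
    unfolding G_def by (intro Bochner_Integration.integral_cong refl) (use uh in auto)
  also have "\<dots> = of_real (\<integral>z. norm (1 - b * z) powr q \<partial>circle_measure)"
    by (rule integral_complex_of_real)
  finally have Gb: "norm (G b) = (\<integral>z. norm (1 - b * z) powr q \<partial>circle_measure)"
    by (simp add: integral_nonneg_AE)
  have "norm (G b) \<le> (\<integral>z. norm (1 + of_real \<rho> * z) powr q \<partial>circle_measure)"
  proof (rule maximum_modulus_ball[OF G \<rho> \<open>\<rho> < 1\<close>])
    fix w :: complex assume w: "norm w = \<rho>"
    have "norm (G w) \<le> (\<integral>z. norm (u z * h (w * z)) \<partial>circle_measure)"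
      unfolding G_def by (rule integral_norm_bound)
    also have "\<dots> = (\<integral>z. norm (1 - w * z) powr q \<partial>circle_measure)"
      by (intro Bochner_Integration.integral_cong refl) (use w b nu norm_h in \<open>auto simp: norm_mult\<close>)
    \<comment> \<open>Since |w| = \<rho>, the factor \<open>- w / of_real \<rho>\<close> is
      unimodular and can be rotated away.\<close>
    also have "\<dots> = (\<integral>z. norm (1 + of_real \<rho> * ((- w / of_real \<rho>) * z)) powr q \<partial>circle_measure)"
      using \<rho> by simp
    also have "\<dots> = (\<integral>z. norm (1 + of_real \<rho> * z) powr q \<partial>circle_measure)"
      using w \<rho> q
      by (intro integral_circle_rotate[where f = "\<lambda>z. norm (1 + of_real \<rho> * z) powr q"])
        (auto intro!: continuous_intros simp: norm_divide)
    finally show "norm (G w) \<le> (\<integral>z. norm (1 + of_real \<rho> * z) powr q \<partial>circle_measure)" .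
  qed (use b in auto)
  then show ?thesis
    using Gb by simp
qed

text \<open>For |b| = 1 the two sides agree by rotation. For |b| < 1 compare with radii
  \<open>r n\<close> between |b| and 1, and let them tend to 1 by dominated convergence with the
  constant bound \<open>2 powr q\<close>.\<close>

lemma integral_powr_one_minus_le:
  fixes q :: real
  assumes b: "norm b \<le> 1" and q: "q > 0"
  shows "(\<integral>z. norm (1 - b * z) powr q \<partial>circle_measure) \<le> (\<integral>z. norm (1 + z) powr q \<partial>circle_measure)"
proof (cases "norm b = 1")
  case True
  have "(\<integral>z. norm (1 - b * z) powr q \<partial>circle_measure) = (\<integral>z. norm (1 + (- b) * z) powr q \<partial>circle_measure)"
    by simp
  also have "\<dots> = (\<integral>z. norm (1 + z) powr q \<partial>circle_measure)"
    using True q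
    by (intro integral_circle_rotate[where f = "\<lambda>z. norm (1 + z) powr q"])
      (auto intro!: continuous_intros)
  finally show ?thesis by simp
next
  case False
  define r :: "nat \<Rightarrow> real" where "r n = 1 - inverse (real (Suc n) + 1)" for n
  have r: "0 < r n" "r n < 1" for n
    by (auto simp: r_def field_simps)
  have rlim: "r \<longlonglongrightarrow> 1"
    unfolding r_def by real_asymp
  have "(\<lambda>n. \<integral>z. norm (1 + of_real (r n) * z) powr q \<partial>circle_measure) \<longlonglongrightarrow>
      (\<integral>z. norm (1 + z) powr q \<partial>circle_measure)"
  proof (rule integral_dominated_convergence[where w = "\<lambda>_. 2 powr q"])
    show "AE z in circle_measure. (\<lambda>n. norm (1 + of_real (r n) * z) powr q) \<longlonglongrightarrow> norm (1 + z) powr q"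
    proof (rule AE_I2)
      fix z :: complex
      have "(\<lambda>n. norm (1 + of_real (r n) * z) powr q) \<longlonglongrightarrow> norm (1 + of_real 1 * z) powr q"
        using q by (intro tendsto_powr' tendsto_intros rlim) auto
      then show "(\<lambda>n. norm (1 + of_real (r n) * z) powr q) \<longlonglongrightarrow> norm (1 + z) powr q" by simp
    qed
    show "AE z in circle_measure. norm (norm (1 + of_real (r n) * z) powr q) \<le> 2 powr q" for n
    proof (rule AE_I2)
      fix z assume "z \<in> space circle_measure"
      then have "norm (1 + of_real (r n) * z) \<le> 2"
        using norm_triangle_ineq[of 1 "of_real (r n) * z"] r[of n] by (simp add: norm_mult)
      then show "norm (norm (1 + of_real (r n) * z) powr q) \<le> 2 powr q"
        using q by (auto intro!: powr_mono2)
    qed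
  qed (auto intro!: borel_measurable_circle)
  moreover have "eventually (\<lambda>n. norm b < r n) sequentially"
    using order_tendstoD(1)[OF rlim, of "norm b"] False b by simp
  then have "eventually (\<lambda>n. (\<integral>z. norm (1 - b * z) powr q \<partial>circle_measure) \<le>
      (\<integral>z. norm (1 + of_real (r n) * z) powr q \<partial>circle_measure)) sequentially"
    by eventually_elim (intro integral_powr_le_inside r q)
  ultimately show ?thesis
    by (intro tendsto_lowerbound) auto
qed

section \<open>One variable\<close>

text \<open>On the unit circle the inverse of z is its conjugate, so a root in the closed disc can
  be reflected with \<beta> = \<open>cnj \<alpha>\<close>. For a root outside, \<alpha> is factored
  out and \<beta> = \<open>inverse \<alpha>\<close>.\<close>

lemma norm_diff_on_circle:
  fixes \<alpha> :: complex
  obtains \<beta> where "norm \<beta> \<le> 1" "\<And>z. norm z = 1 \<Longrightarrow> norm (z - \<alpha>) = max 1 (norm \<alpha>) * norm (1 - \<beta> * z)"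
proof (cases "norm \<alpha> \<le> 1")
  case True
  have "norm (z - \<alpha>) = norm (1 - cnj \<alpha> * z)" if z: "norm z = 1" for z
  proof -
    have "z * cnj z = 1"
      using z complex_norm_square[of z] by simp
    then have "z - \<alpha> = z * cnj (1 - cnj \<alpha> * z)"
      by (simp add: algebra_simps flip: mult.assoc)
    then show ?thesis
      using z by (metis norm_mult complex_mod_cnj mult_1)
  qed
  then show ?thesis
    using True that[of "cnj \<alpha>"] by (simp add: max_def)
next
  case False
  then have "\<alpha> \<noteq> 0" by auto
  then have "norm (z - \<alpha>) = norm \<alpha> * norm (1 - inverse \<alpha> * z)" for z
  proof -
    have "norm \<alpha> * norm (1 - inverse \<alpha> * z) = norm (\<alpha> - z)"
      using \<open>\<alpha> \<noteq> 0\<close> by (simp add: right_diff_distrib flip: norm_mult mult.assoc)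
    then show ?thesis by (simp add: norm_minus_commute)
  qed
  then show ?thesis
    using False that[of "inverse \<alpha>"] by (auto simp: max_def norm_inverse inverse_le_1_iff)
qed

text \<open>One root is split off at a time. The number of factors is the bound \<open>D\<close> and
  not the degree: missing factors are padded with \<open>b i = 0\<close>, so that slices of varying
  degree are treated uniformly. Each root multiplies \<open>C\<close> by max 1 |\<alpha>|, so
  \<open>C\<close> never falls below the modulus of the leading coefficient.\<close>

lemma norm_poly_on_circle:
  fixes p :: "complex poly"
  assumes "p \<noteq> 0" "degree p \<le> D"
  shows "\<exists>C b. norm (lead_coeff p) \<le> C \<and> (\<forall>i. norm (b i) \<le> 1) \<and>
    (\<forall>z. norm z = 1 \<longrightarrow> norm (poly p z) = C * (\<Prod>i<D. norm (1 - b i * z)))"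
  using assms
proof (induction D arbitrary: p)
  case 0
  then obtain c where "p = [:c:]"
    by (auto elim: degree_eq_zeroE)
  then show ?case
    by (auto intro!: exI[of _ "\<lambda>_. 0"])
next
  case (Suc D)
  show ?case
  proof (cases "degree p \<le> D")
    case True
    then obtain C b where "norm (lead_coeff p) \<le> C" "\<forall>i. norm (b i) \<le> 1"
        "\<forall>z. norm z = 1 \<longrightarrow> norm (poly p z) = C * (\<Prod>i<D. norm (1 - b i * z))"
      using Suc by blast
    then show ?thesis
      by (intro exI[of _ C] exI[of _ "b(D := 0)"]) auto
  next
    case False
    then obtain \<alpha> where "poly p \<alpha> = 0"
      using alg_closed_imp_poly_has_root[of p] by auto
    then obtain q where q: "p = [:-\<alpha>, 1:] * q"
      by (auto simp: poly_eq_0_iff_dvd)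
    have "q \<noteq> 0" using Suc.prems q by auto
    then have "degree p = Suc (degree q)"
      unfolding q by (subst degree_mult_eq) auto
    then obtain C b where Cb: "norm (lead_coeff q) \<le> C" "\<forall>i. norm (b i) \<le> 1"
        "\<forall>z. norm z = 1 \<longrightarrow> norm (poly q z) = C * (\<Prod>i<D. norm (1 - b i * z))"
      using Suc.IH[of q] Suc.prems \<open>q \<noteq> 0\<close> by auto
    obtain \<beta> where \<beta>: "norm \<beta> \<le> 1"
      "\<And>z. norm z = 1 \<Longrightarrow> norm (z - \<alpha>) = max 1 (norm \<alpha>) * norm (1 - \<beta> * z)"
      using norm_diff_on_circle by blast
    have "lead_coeff p = lead_coeff q"
      unfolding q lead_coeff_mult by simp
    moreover have "0 \<le> C"
      using Cb(1) norm_ge_zero order_trans by blast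
    ultimately have "norm (lead_coeff p) \<le> max 1 (norm \<alpha>) * C"
      using Cb(1) mult_right_mono[of 1 "max 1 (norm \<alpha>)" C] by simp
    moreover have "norm (poly p z) = max 1 (norm \<alpha>) * C * (\<Prod>i<Suc D. norm (1 - (b(D := \<beta>)) i * z))"
      if "norm z = 1" for z
    proof -
      have "norm (poly p z) = norm (z - \<alpha>) * norm (poly q z)"
        unfolding q by (simp add: algebra_simps flip: norm_mult)
      then show ?thesis
        using that Cb(3) \<beta>(2) by simp
    qed
    ultimately show ?thesis
      using Cb(2) \<beta>(1) by (intro exI[of _ "max 1 (norm \<alpha>) * C"] exI[of _ "b(D := \<beta>)"]) auto
  qed
qed

section \<open>The constants \<open>Lambda_const\<close> and the one-variable inequality\<close>

lemma Lambda_const_nonneg [simp]: "0 \<le> Lambda_const r m"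
  by (simp add: Lambda_const_def)

lemma Lambda_const_powr:
  "r > 0 \<Longrightarrow> Lambda_const r m powr r = (\<integral>z. norm (1 + z) powr (real m * r) \<partial>circle_measure)"
  by (simp add: Lambda_const_def powr_powr integral_nonneg_AE)

lemma Lambda_const_0: "Lambda_const r 0 = 1"
proof -
  have "(\<integral>z. norm (1 + z) powr 0 \<partial>circle_measure) = (\<integral>z. 1 \<partial>circle_measure)"
    using AE_circle_neq[of "-1"]
    by (intro integral_cong_AE) (auto intro!: borel_measurable_circle simp: add_eq_0_iff elim!: eventually_mono)
  then show ?thesis by (simp add: Lambda_const_def)
qed

text \<open>Everything is read off from the factorization of |p| on the circle: the linear factors
  have logarithmic mean 0, so the mean of ln |p| is \<open>ln C\<close>.\<close>

lemma univariate_mahler: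
  fixes p :: "complex poly"
  assumes p: "p \<noteq> 0" "degree p \<le> D"
  shows AE_poly_nonzero: "AE z in circle_measure. poly p z \<noteq> 0"
    and integrable_ln_poly: "integrable circle_measure (\<lambda>z. ln (norm (poly p z)))"
    and integral_ln_poly_ge: "ln (norm (lead_coeff p)) \<le> (\<integral>z. ln (norm (poly p z)) \<partial>circle_measure)"
    and integral_powr_poly_le: "r > 0 \<Longrightarrow> (\<integral>z. norm (poly p z) powr r \<partial>circle_measure) \<le>
      Lambda_const r D powr r * exp (r * (\<integral>z. ln (norm (poly p z)) \<partial>circle_measure))"
proof -
  obtain C b where lC: "norm (lead_coeff p) \<le> C" and b: "norm (b i) \<le> 1"
    and eq: "norm z = 1 \<Longrightarrow> norm (poly p z) = C * (\<Prod>i<D. norm (1 - b i * z))" for i z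
    using norm_poly_on_circle[OF p] by blast
  have C: "0 < C" using lC p(1) by (meson leading_coeff_0_iff order_less_le_trans zero_less_norm_iff)
  have "1 - b i * z \<noteq> 0" if "z \<noteq> inverse (b i)" for i z
    using that inverse_unique[of "b i" z] by auto
  then have ne: "AE z in circle_measure. \<forall>i\<in>{..<D}. 1 - b i * z \<noteq> 0"
    by (intro AE_finite_allI) (auto intro!: eventually_mono[OF AE_circle_neq])
  show "AE z in circle_measure. poly p z \<noteq> 0"
    using ne AE_space
  proof eventually_elim
    case (elim z)
    then have "0 < C * (\<Prod>i<D. norm (1 - b i * z))"
      using C by (intro mult_pos_pos prod_pos) auto
    then show ?case using eq[of z] elim by auto
  qed
  have [measurable]: "poly p \<in> borel_measurable circle_measure"
    by (intro borel_measurable_circle borel_measurable_continuous_onI continuous_intros)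
  have "has_bochner_integral circle_measure (\<lambda>z. ln C + (\<Sum>i<D. ln (norm (1 - b i * z)))) (ln C + (\<Sum>i<D. 0))"
    (is ?sum)
    using integrable_ln_one_minus[OF b] integral_ln_one_minus[OF b]
    by (intro has_bochner_integral_add has_bochner_integral_sum) (auto simp: has_bochner_integral_iff)
  also have "?sum \<longleftrightarrow> has_bochner_integral circle_measure (\<lambda>z. ln (norm (poly p z))) (ln C)"
  proof (simp only: sum.neutral_const add_0_right, intro has_bochner_integral_cong_AE)
    show "AE z in circle_measure. ln C + (\<Sum>i<D. ln (norm (1 - b i * z))) = ln (norm (poly p z))"
      using ne AE_space
    proof eventually_elim
      case (elim z)
      then have "0 < (\<Prod>i<D. norm (1 - b i * z))"
        by (intro prod_pos) auto
      then show ?case using eq[of z] elim C by (simp add: ln_mult) (subst ln_prod, auto)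
    qed
  qed (auto intro!: borel_measurable_circle)
  finally have hbi: "has_bochner_integral circle_measure (\<lambda>z. ln (norm (poly p z))) (ln C)" .
  then show "integrable circle_measure (\<lambda>z. ln (norm (poly p z)))"
    by (simp add: has_bochner_integral_iff)
  have int_eq: "(\<integral>z. ln (norm (poly p z)) \<partial>circle_measure) = ln C"
    using hbi by (simp add: has_bochner_integral_iff)
  then show "ln (norm (lead_coeff p)) \<le> (\<integral>z. ln (norm (poly p z)) \<partial>circle_measure)"
    using lC p(1) C by simp
  assume r: "r > 0"
  show "(\<integral>z. norm (poly p z) powr r \<partial>circle_measure) \<le>
      Lambda_const r D powr r * exp (r * (\<integral>z. ln (norm (poly p z)) \<partial>circle_measure))"
  \<comment> \<open>The average over \<open>D\<close> factors makes sense only for positive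
    \<open>D\<close>; for \<open>D = 0\<close> the modulus is the constant \<open>C\<close> and
    \<open>Lambda_const r 0\<close> is 1.\<close>
  proof (cases "D = 0")
    case True
    have "(\<integral>z. norm (poly p z) powr r \<partial>circle_measure) = (\<integral>z. C powr r \<partial>circle_measure)"
      using eq True by (intro Bochner_Integration.integral_cong refl) auto
    then show ?thesis
      using True C unfolding int_eq by (simp add: Lambda_const_0 powr_def)
  next
    case False
    define q where "q = real D * r"
    have q: "q > 0" using False r by (simp add: q_def)
    have int_q: "integrable circle_measure (\<lambda>z. norm (1 - b i * z) powr q)" for i
      by (intro integrable_circle_continuous continuous_intros q)
    have "(\<integral>z. norm (poly p z) powr r \<partial>circle_measure) \<le>
        (\<integral>z. C powr r * ((\<Sum>i<D. norm (1 - b i * z) powr q) / real D) \<partial>circle_measure)"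
    proof (rule integral_mono)
      show "integrable circle_measure (\<lambda>z. norm (poly p z) powr r)"
        using r by (intro integrable_circle_continuous continuous_intros)
      fix z assume "z \<in> space circle_measure"
      then have z: "norm z = 1" by simp
      \<comment> \<open>With \<open>q = D * r\<close>, the r-th power of the product is the
        geometric mean of the q-th powers of the factors.\<close>
      have "(\<Prod>i<D. norm (1 - b i * z)) powr r = (\<Prod>i<D. norm (1 - b i * z) powr q) powr (1 / real (card {..<D}))"
        using False by (simp add: q_def prod_nonneg powr_powr flip: prod_powr_distrib)
      also have "\<dots> \<le> (\<Sum>i<D. norm (1 - b i * z) powr q / real (card {..<D}))"
        using False by (intro arith_geom_mean) auto
      finally have "(\<Prod>i<D. norm (1 - b i * z)) powr r \<le> (\<Sum>i<D. norm (1 - b i * z) powr q) / real D"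
        by (simp add: sum_divide_distrib)
      then show "norm (poly p z) powr r \<le> C powr r * ((\<Sum>i<D. norm (1 - b i * z) powr q) / real D)"
        using C z by (simp add: eq powr_mult prod_nonneg del: times_divide_eq_right)
    qed (use int_q in auto)
    also have "\<dots> = C powr r * ((\<Sum>i<D. (\<integral>z. norm (1 - b i * z) powr q \<partial>circle_measure)) / real D)"
      using int_q by (simp add: Bochner_Integration.integral_sum)
    also have "\<dots> \<le> C powr r * ((\<Sum>i<D. Lambda_const r D powr r) / real D)"
      using r integral_powr_one_minus_le[OF b q]
      by (intro mult_left_mono divide_right_mono sum_mono) (auto simp: Lambda_const_powr q_def)
    also have "\<dots> = Lambda_const r D powr r * exp (r * ln C)"
      using False C by (simp add: powr_def)
    finally show ?thesis by (simp add: int_eq)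
  qed
qed

section \<open>Several variables\<close>

text \<open>Jensen's inequality for the exponential; with the nonnegative integral on the right, a
  divergent integral of \<open>exp (X x)\<close> is covered as the trivial case.\<close>

lemma (in prob_space) exp_integral_le_nn_integral:
  assumes X: "integrable M X"
  shows "ennreal (exp (\<integral>x. X x \<partial>M)) \<le> (\<integral>\<^sup>+x. ennreal (exp (X x)) \<partial>M)"
proof (cases "(\<integral>\<^sup>+x. ennreal (exp (X x)) \<partial>M) < \<infinity>")
  case True
  then have int: "integrable M (\<lambda>x. exp (X x))"
    using X by (intro integrableI_nonneg) auto
  have "exp (\<integral>x. X x \<partial>M) \<le> (\<integral>x. exp (X x) \<partial>M)"
    by (rule jensens_inequality[OF X _ _ int exp_convex]) auto
  then show ?thesis
    using int by (simp add: nn_integral_eq_integral ennreal_leI)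
qed (simp add: not_less top_unique)

text \<open>
  Jensen's inequality is applied to \<open>ln (g (x, y)) - L x\<close>, where \<open>L\<close> is the logarithmic mean of \<open>g\<close>
  over the second variable, so that the normalized function \<open>g (x, y) * exp (- L x)\<close> has integral
  at most \<open>B\<close> in \<open>y\<close>.
\<close>

lemma nn_integral_pair_le_exp:
  fixes g :: "'a \<times> 'b \<Rightarrow> real"
  assumes "prob_space M" "prob_space N"
    and g [measurable]: "g \<in> borel_measurable (M \<Otimes>\<^sub>M N)"
    and pos: "AE z in M \<Otimes>\<^sub>M N. 0 < g z"
    and int: "integrable (M \<Otimes>\<^sub>M N) (\<lambda>z. ln (g z))"
    and A: "0 \<le> A" and B: "0 \<le> B"
    and x: "AE x in M. (\<integral>\<^sup>+y. g (x, y) \<partial>N) \<le> ennreal (B * exp (\<integral>y. ln (g (x, y)) \<partial>N))"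
    and y: "AE y in N. (\<integral>\<^sup>+x. g (x, y) \<partial>M) \<le> ennreal (A * exp (\<integral>x. ln (g (x, y)) \<partial>M))"
  shows "(\<integral>\<^sup>+z. g z \<partial>(M \<Otimes>\<^sub>M N)) \<le> ennreal (A * B * exp (\<integral>z. ln (g z) \<partial>(M \<Otimes>\<^sub>M N)))"
proof -
  interpret M: prob_space M by fact
  interpret N: prob_space N by fact
  interpret P: pair_sigma_finite M N ..
  define L where "L = (\<lambda>x. \<integral>y. ln (g (x, y)) \<partial>N)"
  define I where "I = (\<integral>z. ln (g z) \<partial>(M \<Otimes>\<^sub>M N))"
  have L: "integrable M L" and IL: "integral\<^sup>L M L = I"
    using P.integrable_fst'[OF int] P.integral_fst'[OF int] by (simp_all add: L_def I_def)
  have [measurable]: "L \<in> borel_measurable M"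
    using L by simp
  have "AE y in N. AE x in M. 0 < g (x, y)"
    using pos P.AE_pair[OF pos] by (subst P.AE_commute[symmetric]) auto
  moreover have "AE y in N. integrable M (\<lambda>x. ln (g (x, y)))"
    using P.AE_integrable_snd[of "\<lambda>x y. ln (g (x, y))"] int by (simp add: case_prod_unfold)
  ultimately have le: "AE y in N. (\<integral>\<^sup>+x. g (x, y) \<partial>M) \<le>
      ennreal (A * exp I) * (\<integral>\<^sup>+x. ennreal (g (x, y) * exp (- L x)) \<partial>M)"
    using y
  proof eventually_elim
    case (elim y)
    have "ennreal (exp (\<integral>x. ln (g (x, y)) - L x \<partial>M)) \<le> (\<integral>\<^sup>+x. ennreal (exp (ln (g (x, y)) - L x)) \<partial>M)"
      using elim L by (intro M.exp_integral_le_nn_integral) auto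
    also have "\<dots> = (\<integral>\<^sup>+x. ennreal (g (x, y) * exp (- L x)) \<partial>M)"
    proof (rule nn_integral_cong_AE, use elim(1) in eventually_elim)
      fix x assume "0 < g (x, y)"
      then show "ennreal (exp (ln (g (x, y)) - L x)) = ennreal (g (x, y) * exp (- L x))"
        by (simp add: exp_diff exp_minus divide_inverse)
    qed
    finally have *: "ennreal (exp (\<integral>x. ln (g (x, y)) - L x \<partial>M)) \<le> (\<integral>\<^sup>+x. ennreal (g (x, y) * exp (- L x)) \<partial>M)" .
    \<comment> \<open>The integral of \<open>L\<close> is \<open>I\<close>, so subtracting
      \<open>L\<close> in the exponent costs exactly the factor \<open>exp I\<close>, which no
      longer depends on \<open>y\<close>.\<close>
    have "exp (\<integral>x. ln (g (x, y)) \<partial>M) = exp I * exp (\<integral>x. ln (g (x, y)) - L x \<partial>M)"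
      using elim L IL by (simp flip: exp_add)
    then have "ennreal (A * exp (\<integral>x. ln (g (x, y)) \<partial>M)) =
        ennreal (A * exp I) * ennreal (exp (\<integral>x. ln (g (x, y)) - L x \<partial>M))"
      using A by (simp add: mult.assoc flip: ennreal_mult)
    also have "\<dots> \<le> ennreal (A * exp I) * (\<integral>\<^sup>+x. ennreal (g (x, y) * exp (- L x)) \<partial>M)"
      by (intro mult_left_mono *) auto
    finally show ?case using elim(3) by (rule order_trans[rotated])
  qed
  have "(\<integral>\<^sup>+z. g z \<partial>(M \<Otimes>\<^sub>M N)) = (\<integral>\<^sup>+y. \<integral>\<^sup>+x. g (x, y) \<partial>M \<partial>N)"
    by (rule P.nn_integral_snd[symmetric]) measurable
  also have "\<dots> \<le> (\<integral>\<^sup>+y. ennreal (A * exp I) * (\<integral>\<^sup>+x. ennreal (g (x, y) * exp (- L x)) \<partial>M) \<partial>N)"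
    using le by (rule nn_integral_mono_AE)
  also have "\<dots> = ennreal (A * exp I) * (\<integral>\<^sup>+y. \<integral>\<^sup>+x. ennreal (g (x, y) * exp (- L x)) \<partial>M \<partial>N)"
    by (rule nn_integral_cmult) measurable
  \<comment> \<open>After the exchange the inner integral runs over \<open>y\<close>, where
    \<open>exp (- L x)\<close> is constant and cancels the exponential in the bound for fixed
    \<open>x\<close>.\<close>
  also have "(\<integral>\<^sup>+y. \<integral>\<^sup>+x. ennreal (g (x, y) * exp (- L x)) \<partial>M \<partial>N) =
      (\<integral>\<^sup>+x. \<integral>\<^sup>+y. ennreal (g (x, y) * exp (- L x)) \<partial>N \<partial>M)"
    by (rule P.Fubini') measurable
  also have "\<dots> \<le> (\<integral>\<^sup>+x. ennreal B \<partial>M)"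
  proof (rule nn_integral_mono_AE, use x AE_space in eventually_elim)
    case (elim x)
    then have [measurable]: "x \<in> space M" by simp
    have "(\<integral>\<^sup>+y. ennreal (g (x, y) * exp (- L x)) \<partial>N) = (\<integral>\<^sup>+y. ennreal (g (x, y)) * ennreal (exp (- L x)) \<partial>N)"
      by (intro nn_integral_cong) (simp add: ennreal_mult'')
    also have "\<dots> = (\<integral>\<^sup>+y. ennreal (g (x, y)) \<partial>N) * ennreal (exp (- L x))"
      by (rule nn_integral_multc) measurable
    also have "\<dots> \<le> ennreal (B * exp (L x)) * ennreal (exp (- L x))"
      using elim(1) by (intro mult_right_mono) (auto simp: L_def)
    also have "\<dots> = ennreal B"
      using B by (simp add: mult.assoc flip: ennreal_mult exp_add)
    finally show ?case .
  qed
  also have "\<dots> = ennreal B"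
    by (simp add: M.emeasure_space_1)
  finally have "(\<integral>\<^sup>+z. g z \<partial>(M \<Otimes>\<^sub>M N)) \<le> ennreal (A * exp I) * ennreal B"
    by (simp add: mult_left_mono)
  then show ?thesis
    using A B by (simp add: I_def mult_ac flip: ennreal_mult)
qed

section \<open>The torus as an iterated product, and monomial sums on it\<close>

lemma prob_space_torus_measure: "prob_space (torus_measure n)"
  unfolding torus_measure_def by (intro prob_space_PiM prob_space_circle_measure)

interpretation torus: prob_space "torus_measure n" for n
  by (rule prob_space_torus_measure)

lemma space_torus_measure: "space (torus_measure n) = {..<n} \<rightarrow>\<^sub>E sphere 0 1"
  by (simp add: torus_measure_def space_PiM)

lemma measurable_torus_upd:
  "(\<lambda>(x, w). x(n := w)) \<in> torus_measure n \<Otimes>\<^sub>M circle_measure \<rightarrow>\<^sub>M torus_measure (Suc n)"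
  unfolding torus_measure_def lessThan_Suc by (rule measurable_add_dim)

text \<open>The product decomposition for an inserted index puts the new coordinate first; swapping
  the factors puts the last variable second, as in the two-factor inequality.\<close>

lemma torus_measure_Suc:
  "torus_measure (Suc n) = distr (torus_measure n \<Otimes>\<^sub>M circle_measure) (torus_measure (Suc n)) (\<lambda>(x, w). x(n := w))"
proof -
  interpret pair_sigma_finite circle_measure "torus_measure n" ..
  have m: "(\<lambda>(w, x). x(n := w)) \<in> circle_measure \<Otimes>\<^sub>M torus_measure n \<rightarrow>\<^sub>M torus_measure (Suc n)"
    using measurable_compose[OF measurable_pair_swap' measurable_torus_upd] by (simp add: case_prod_unfold)
  have "torus_measure (Suc n) = distr (circle_measure \<Otimes>\<^sub>M torus_measure n) (torus_measure (Suc n)) (\<lambda>(w, x). x(n := w))"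
    using distr_pair_PiM_eq_PiM[of "{..<n}" "\<lambda>_. circle_measure" n] prob_space_circle_measure
    by (simp add: torus_measure_def lessThan_Suc)
  also have "\<dots> = distr (torus_measure n \<Otimes>\<^sub>M circle_measure) (torus_measure (Suc n)) (\<lambda>(x, w). x(n := w))"
    by (subst distr_pair_swap, subst distr_distr[OF m measurable_pair_swap'])
      (simp add: comp_def case_prod_unfold)
  finally show ?thesis .
qed

text \<open>Index set and coefficients are separate arguments, and coefficients may vanish. Freezing
  or extracting a variable then changes only \<open>c\<close>, so the induction keeps
  \<open>A\<close> and the degree bounds fixed.\<close>

definition monomial_sum :: "multi_index set \<Rightarrow> (multi_index \<Rightarrow> complex) \<Rightarrow> nat \<Rightarrow> (nat \<Rightarrow> complex) \<Rightarrow> complex" where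
  "monomial_sum A c n z = (\<Sum>\<alpha>\<in>A. c \<alpha> * (\<Prod>j<n. z j ^ Poly_Mapping.lookup \<alpha> j))"

lemma measurable_torus_component: "j < n \<Longrightarrow> (\<lambda>z. z j) \<in> borel_measurable (torus_measure n)"
  unfolding torus_measure_def
  by (rule measurable_compose[OF _ measurable_circle_ident], rule measurable_component_singleton) simp

lemma measurable_monomial_sum [measurable]:
  "monomial_sum A c n \<in> borel_measurable (torus_measure n)"
  unfolding monomial_sum_def[abs_def]
  by (intro borel_measurable_sum borel_measurable_times borel_measurable_prod borel_measurable_power
      borel_measurable_const measurable_torus_component) auto

lemma norm_monomial_sum_le:
  assumes "z \<in> space (torus_measure n)"
  shows "norm (monomial_sum A c n z) \<le> (\<Sum>\<alpha>\<in>A. norm (c \<alpha>))"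
proof -
  have "norm (z j) = 1" if "j < n" for j
    using assms that by (auto simp: space_torus_measure PiE_iff)
  then have "norm (\<Prod>j<n. z j ^ Poly_Mapping.lookup \<alpha> j) = 1" for \<alpha> :: multi_index
    by (simp add: prod_norm[symmetric] norm_power)
  then show ?thesis
    unfolding monomial_sum_def by (intro sum_norm_le) (simp add: norm_mult)
qed

lemma integrable_monomial_sum_powr:
  assumes "p > 0"
  shows "integrable (torus_measure n) (\<lambda>z. norm (monomial_sum A c n z) powr p)"
  by (rule torus.integrable_const_bound[where B = "(\<Sum>\<alpha>\<in>A. norm (c \<alpha>)) powr p"])
    (use assms norm_monomial_sum_le in \<open>auto intro!: powr_mono2\<close>)

lemma monomial_sum_upd:
  "monomial_sum A c (Suc n) (x(n := w)) =
    monomial_sum A (\<lambda>\<alpha>. c \<alpha> * w ^ Poly_Mapping.lookup \<alpha> n) n x"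
  unfolding monomial_sum_def lessThan_Suc by (simp add: mult_ac)

text \<open>Grouping by the exponent of the last variable gives a polynomial in \<open>w\<close>
  whose coefficients are monomial sums in the first \<open>n\<close> variables.\<close>

lemma monomial_sum_poly:
  assumes "finite A" and D: "\<And>\<alpha>. \<alpha> \<in> A \<Longrightarrow> Poly_Mapping.lookup \<alpha> n \<le> D"
  shows "monomial_sum A c (Suc n) (x(n := w)) =
    poly (\<Sum>k\<le>D. monom (monomial_sum A (\<lambda>\<alpha>. if Poly_Mapping.lookup \<alpha> n = k then c \<alpha> else 0) n x) k) w"
proof -
  have "(\<Sum>k\<le>D. monomial_sum A (\<lambda>\<alpha>. if Poly_Mapping.lookup \<alpha> n = k then c \<alpha> else 0) n x * w ^ k) =
      (\<Sum>\<alpha>\<in>A. \<Sum>k\<le>D. (if Poly_Mapping.lookup \<alpha> n = k then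
        c \<alpha> * w ^ k * (\<Prod>j<n. x j ^ Poly_Mapping.lookup \<alpha> j) else 0))"
    unfolding monomial_sum_def sum_distrib_right
    by (subst sum.swap) (intro sum.cong refl, auto simp: mult_ac)
  also have "\<dots> = monomial_sum A (\<lambda>\<alpha>. c \<alpha> * w ^ Poly_Mapping.lookup \<alpha> n) n x"
    unfolding monomial_sum_def using D by (intro sum.cong refl) (simp add: sum.delta)
  finally show ?thesis
    by (simp add: monomial_sum_upd poly_sum poly_monom)
qed

text \<open>The logarithm is bounded above on the torus, so only its negative part matters. Its
  absolute value is at most \<open>2 * ln K - l\<close>, whose slice integrals are at most
  \<open>2 * ln K - h x\<close>; Fubini's criterion then applies.\<close>

lemma integrable_monomial_sum_slice:
  assumes "AE x in torus_measure n. integrable circle_measure (\<lambda>w. ln (norm (monomial_sum A c (Suc n) (x(n := w)))))"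
    and "AE x in torus_measure n. h x \<le> (\<integral>w. ln (norm (monomial_sum A c (Suc n) (x(n := w)))) \<partial>circle_measure)"
    and h: "integrable (torus_measure n) h"
  shows "integrable (torus_measure n \<Otimes>\<^sub>M circle_measure) (\<lambda>(x, w). ln (norm (monomial_sum A c (Suc n) (x(n := w)))))"
proof -
  interpret pair_sigma_finite "torus_measure n" circle_measure ..
  \<comment> \<open>The maximum with 1 makes \<open>ln K\<close> nonnegative, so that the upper
    bound by \<open>ln K\<close> survives at zeros, where \<open>ln 0 = 0\<close>.\<close>
  define K where "K = max 1 (\<Sum>\<alpha>\<in>A. norm (c \<alpha>))"
  define l where "l = (\<lambda>(x, w). ln (norm (monomial_sum A c (Suc n) (x(n := w)))))"
  have [measurable]: "l \<in> borel_measurable (torus_measure n \<Otimes>\<^sub>M circle_measure)"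
    using measurable_compose[OF measurable_torus_upd[of n], of "\<lambda>z. ln (norm (monomial_sum A c (Suc n) z))" borel]
    by (simp add: l_def case_prod_unfold)
  have le: "norm (l (x, w)) \<le> 2 * ln K - l (x, w)"
    if "x \<in> space (torus_measure n)" "w \<in> space circle_measure" for x w
  proof -
    have "x(n := w) \<in> space (torus_measure (Suc n))"
      using that measurable_space[OF measurable_torus_upd, of "(x, w)"] by (simp add: space_pair_measure)
    then have "norm (monomial_sum A c (Suc n) (x(n := w))) \<le> K"
      using norm_monomial_sum_le[of "x(n := w)" "Suc n" A c] by (simp add: K_def)
    then have "l (x, w) \<le> ln K"
      by (cases "monomial_sum A c (Suc n) (x(n := w)) = 0") (auto simp: l_def K_def)
    moreover have "0 \<le> ln K" by (simp add: K_def)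
    ultimately show ?thesis by simp
  qed
  have "integrable (torus_measure n \<Otimes>\<^sub>M circle_measure) l"
  proof (rule Fubini_integrable)
    show "integrable (torus_measure n) (\<lambda>x. \<integral>w. norm (l (x, w)) \<partial>circle_measure)"
    proof (rule Bochner_Integration.integrable_bound[of _ "\<lambda>x. 2 * ln K - h x"])
      show "AE x in torus_measure n. norm (\<integral>w. norm (l (x, w)) \<partial>circle_measure) \<le> norm (2 * ln K - h x)"
        using assms(1,2) AE_space
      proof eventually_elim
        case (elim x)
        have "(\<integral>w. norm (l (x, w)) \<partial>circle_measure) \<le> (\<integral>w. 2 * ln K - l (x, w) \<partial>circle_measure)"
          using elim le by (intro integral_mono) (auto simp: l_def)
        also have "\<dots> \<le> 2 * ln K - h x"
          using elim by (simp add: l_def)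
        finally show ?case
          by (smt (verit) integral_nonneg_AE AE_I2 norm_ge_zero real_norm_def)
      qed
    qed (use h in auto)
    show "AE x in torus_measure n. integrable circle_measure (\<lambda>w. l (x, w))"
      using assms(1) by (simp add: l_def)
  qed measurable
  then show ?thesis by (simp add: l_def)
qed

section \<open>Induction on the number of variables\<close>

lemma lead_coeff_sum_monom:
  assumes "m \<le> D" "a m \<noteq> 0" "\<And>k. m < k \<Longrightarrow> k \<le> D \<Longrightarrow> a k = 0"
  shows "lead_coeff (\<Sum>k\<le>D. monom (a k) k) = a m"
proof -
  have coeff: "coeff (\<Sum>k\<le>D. monom (a k) k) i = (if i \<le> D then a i else 0)" for i
    by (simp add: coeff_sum)
  have "degree (\<Sum>k\<le>D. monom (a k) k) = m"
    using assms by (intro order_antisym degree_le le_degree) (auto simp: coeff)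
  then show ?thesis
    using assms(1) by (simp add: coeff)
qed

lemma degree_sum_monom_le: "degree (\<Sum>k\<le>D. monom (a k) k) \<le> D"
  by (rule degree_sum_le) (auto intro: order_trans[OF degree_monom_le])

text \<open>The inequality in p-th power form, so \<open>K\<close> stands for the p-th power of the
  constant. Integrability and nonvanishing almost everywhere are included because the induction must
  pass them on.\<close>

definition Lp_mahler_ineq :: "real \<Rightarrow> real \<Rightarrow> nat \<Rightarrow> ((nat \<Rightarrow> complex) \<Rightarrow> complex) \<Rightarrow> bool" where
  "Lp_mahler_ineq K p n f \<longleftrightarrow>
     (AE z in torus_measure n. f z \<noteq> 0) \<and>
     integrable (torus_measure n) (\<lambda>z. ln (norm (f z))) \<and>
     (\<integral>z. norm (f z) powr p \<partial>torus_measure n) \<le> K * exp (p * (\<integral>z. ln (norm (f z)) \<partial>torus_measure n))"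

text \<open>
  The alternative that the sum vanishes almost everywhere makes it unnecessary to know that a
  nonzero polynomial is not the zero function, and covers exceptional slices.
\<close>

lemma Lp_mahler_monomial_sum:
  assumes A: "finite A" and p: "p > 0"
    and D: "\<And>\<alpha> j. \<alpha> \<in> A \<Longrightarrow> j < n \<Longrightarrow> Poly_Mapping.lookup \<alpha> j \<le> D j"
  shows "(AE z in torus_measure n. monomial_sum A c n z = 0) \<or>
    Lp_mahler_ineq (\<Prod>j<n. Lambda_const p (D j) powr p) p n (monomial_sum A c n)"
  using D
proof (induction n arbitrary: c)
  \<comment> \<open>The sum is a constant: either it is 0, or the inequality is an equality with
    empty product 1.\<close>
  case 0
  show ?case
    by (simp add: Lp_mahler_ineq_def monomial_sum_def torus.prob_space powr_def)
next
  case (Suc n)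
  define T where "T = torus_measure n"
  define a where "a = (\<lambda>k. monomial_sum A (\<lambda>\<alpha>. if Poly_Mapping.lookup \<alpha> n = k then c \<alpha> else 0) n)"
  define q where "q = (\<lambda>x. \<Sum>k\<le>D n. monom (a k x) k)"
  define f where "f = monomial_sum A c (Suc n)"
  define F where "F = (\<lambda>(x, w). f (x(n := w)))"
  interpret T: prob_space T
    unfolding T_def by (rule prob_space_torus_measure)
  interpret P: pair_sigma_finite T circle_measure ..
  interpret P: pair_prob_space T circle_measure ..
  have IH: "(AE z in T. monomial_sum A c n z = 0) \<or>
      Lp_mahler_ineq (\<Prod>j<n. Lambda_const p (D j) powr p) p n (monomial_sum A c n)" for c
    unfolding T_def by (rule Suc.IH) (use Suc.prems in auto)
  have Fq: "F (x, w) = poly (q x) w" for x w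
    unfolding F_def f_def q_def a_def case_prod_conv
    by (rule monomial_sum_poly[OF A]) (use Suc.prems in auto)
  have upd: "(\<lambda>(x, w). x(n := w)) \<in> T \<Otimes>\<^sub>M circle_measure \<rightarrow>\<^sub>M torus_measure (Suc n)"
    unfolding T_def by (rule measurable_torus_upd)
  have f [measurable]: "f \<in> borel_measurable (torus_measure (Suc n))"
    unfolding f_def by measurable
  have F [measurable]: "F \<in> borel_measurable (T \<Otimes>\<^sub>M circle_measure)"
    using measurable_compose[OF upd f] by (simp add: F_def case_prod_unfold)
  have torus_eq: "distr (T \<Otimes>\<^sub>M circle_measure) (torus_measure (Suc n)) (\<lambda>(x, w). x(n := w)) = torus_measure (Suc n)"
    unfolding T_def by (rule torus_measure_Suc[symmetric])
  \<comment> \<open>Statements about \<open>f\<close> on the larger torus are pulled back to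
    \<open>F\<close> on the product of \<open>T\<close> and the circle.\<close>
  have AE_transfer: "(AE z in torus_measure (Suc n). R (f z)) \<longleftrightarrow> (AE z in T \<Otimes>\<^sub>M circle_measure. R (F z))"
    if "Measurable.pred borel R" for R
  proof -
    have "{z \<in> space (torus_measure (Suc n)). R (f z)} \<in> sets (torus_measure (Suc n))"
      using that by measurable
    from AE_distr_iff[OF upd this, unfolded torus_eq] show ?thesis
      by (simp add: F_def case_prod_unfold)
  qed
  have integral_transfer: "(\<integral>z. g (f z) \<partial>torus_measure (Suc n)) = (\<integral>z. g (F z) \<partial>(T \<Otimes>\<^sub>M circle_measure))"
    and integrable_transfer: "integrable (torus_measure (Suc n)) (\<lambda>z. g (f z)) \<longleftrightarrow> integrable (T \<Otimes>\<^sub>M circle_measure) (\<lambda>z. g (F z))"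
    if "g \<in> borel_measurable borel" for g :: "complex \<Rightarrow> real"
    using integral_distr[OF upd measurable_compose[OF f that], unfolded torus_eq]
      integrable_distr_eq[OF upd measurable_compose[OF f that], unfolded torus_eq]
    by (simp_all add: F_def case_prod_unfold)
  show ?case
  proof (cases "\<forall>k\<le>D n. AE x in T. a k x = 0")
    case True
    then have "AE x in T. \<forall>k\<in>{..D n}. a k x = 0"
      by (intro AE_finite_allI) auto
    then have "AE x in T. q x = 0"
      by eventually_elim (simp add: q_def)
    then have "AE x in T. AE w in circle_measure. F (x, w) = 0"
      by eventually_elim (simp add: Fq)
    then have "AE z in T \<Otimes>\<^sub>M circle_measure. F z = 0"
      by (intro P.AE_pair_measure) measurable
    then show ?thesis
      using AE_transfer[of "\<lambda>y. y = 0"] by (simp add: f_def)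
  next
    case False
    \<comment> \<open>\<open>m\<close> is the highest exponent of the last variable whose
      coefficient function is not null. The dichotomy of the induction hypothesis upgrades this to
      nonvanishing almost everywhere, so \<open>a m x\<close> is the leading coefficient of almost
      every slice.\<close>
    define S where "S = {k. k \<le> D n \<and> \<not> (AE x in T. a k x = 0)}"
    define m where "m = Max S"
    have "finite S" "S \<noteq> {}"
      using False by (auto simp: S_def)
    then have "m \<in> S" and Sm: "k \<in> S \<Longrightarrow> k \<le> m" for k
      unfolding m_def by auto
    then have m: "m \<le> D n" "\<not> (AE x in T. a m x = 0)"
      by (auto simp: S_def)
    have "AE x in T. \<forall>k\<in>{m<..D n}. a k x = 0"
      using Sm by (intro AE_finite_allI) (force simp: S_def)+
    moreover have am: "Lp_mahler_ineq (\<Prod>j<n. Lambda_const p (D j) powr p) p n (a m)"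
      using IH[of "\<lambda>\<alpha>. if Poly_Mapping.lookup \<alpha> n = m then c \<alpha> else 0"] m(2) by (simp add: a_def)
    then have "AE x in T. a m x \<noteq> 0"
      unfolding Lp_mahler_ineq_def T_def by blast
    ultimately have lead: "AE x in T. q x \<noteq> 0 \<and> lead_coeff (q x) = a m x"
    proof eventually_elim
      case (elim x)
      then have "lead_coeff (q x) = a m x"
        unfolding q_def using m(1) by (intro lead_coeff_sum_monom) auto
      then show ?case using elim by auto
    qed
    have deg: "degree (q x) \<le> D n" for x
      unfolding q_def by (rule degree_sum_monom_le)
    have "AE x in T. AE w in circle_measure. F (x, w) \<noteq> 0"
      using lead by eventually_elim (unfold Fq, rule AE_poly_nonzero[OF _ deg], simp)
    then have nz: "AE z in T \<Otimes>\<^sub>M circle_measure. F z \<noteq> 0"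
      by (intro P.AE_pair_measure) measurable
    have int: "integrable (T \<Otimes>\<^sub>M circle_measure) (\<lambda>z. ln (norm (F z)))"
    proof -
      have "integrable (T \<Otimes>\<^sub>M circle_measure) (\<lambda>(x, w). ln (norm (f (x(n := w)))))"
        unfolding T_def f_def
      proof (rule integrable_monomial_sum_slice)
        \<comment> \<open>The minorant \<open>h\<close> is the logarithm of the leading coefficient,
          integrable by the induction hypothesis.\<close>
        show "integrable (torus_measure n) (\<lambda>x. ln (norm (a m x)))"
          using am by (simp add: Lp_mahler_ineq_def)
        have eq: "monomial_sum A c (Suc n) (x(n := w)) = poly (q x) w" for x w
          using Fq[of x w] by (simp add: F_def f_def)
        show "AE x in torus_measure n. integrable circle_measure (\<lambda>w. ln (norm (monomial_sum A c (Suc n) (x(n := w)))))"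
          unfolding eq using lead unfolding T_def
          by eventually_elim (rule integrable_ln_poly[OF _ deg], simp)
        show "AE x in torus_measure n. ln (norm (a m x)) \<le>
            (\<integral>w. ln (norm (monomial_sum A c (Suc n) (x(n := w)))) \<partial>circle_measure)"
          unfolding eq using lead unfolding T_def
        proof eventually_elim
          case (elim x)
          then show ?case using integral_ln_poly_ge[OF _ deg, of x] by simp
        qed
      qed
      then show ?thesis by (simp add: F_def case_prod_unfold)
    qed
    define A' where "A' = (\<Prod>j<n. Lambda_const p (D j) powr p)"
    define B where "B = Lambda_const p (D n) powr p"
    have AB: "0 \<le> A'" "0 \<le> B"
      by (auto simp: A'_def B_def intro!: prod_nonneg)
    have ln_powr': "ln (norm y powr p) = p * ln (norm y)" for y :: complex
      by (cases "y = 0") (simp_all add: ln_powr)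
    have intF: "integrable (T \<Otimes>\<^sub>M circle_measure) (\<lambda>z. norm (F z) powr p)"
      using integrable_transfer[of "\<lambda>y. norm y powr p"] integrable_monomial_sum_powr[OF p, of "Suc n" A c]
      by (simp add: f_def)
    have "(\<integral>\<^sup>+z. norm (F z) powr p \<partial>(T \<Otimes>\<^sub>M circle_measure)) \<le>
        ennreal (A' * B * exp (\<integral>z. ln (norm (F z) powr p) \<partial>(T \<Otimes>\<^sub>M circle_measure)))"
    \<comment> \<open>For fixed \<open>x\<close> the one-variable inequality gives the factor
      \<open>B\<close>; for fixed \<open>w\<close> the induction hypothesis gives the factor for the
      first \<open>n\<close> variables.\<close>
    proof (rule nn_integral_pair_le_exp)
      show "AE z in T \<Otimes>\<^sub>M circle_measure. 0 < norm (F z) powr p"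
        using nz by eventually_elim simp
      show "integrable (T \<Otimes>\<^sub>M circle_measure) (\<lambda>z. ln (norm (F z) powr p))"
        using int by (simp add: ln_powr')
      show "AE x in T. (\<integral>\<^sup>+w. norm (F (x, w)) powr p \<partial>circle_measure) \<le>
          ennreal (B * exp (\<integral>w. ln (norm (F (x, w)) powr p) \<partial>circle_measure))"
        using lead
      proof eventually_elim
        case (elim x)
        have "integrable circle_measure (\<lambda>w. norm (F (x, w)) powr p)"
          unfolding Fq by (intro integrable_circle_continuous continuous_intros p)
        then show ?case
          using integral_powr_poly_le[OF _ deg p, of x] elim
          by (simp add: nn_integral_eq_integral ln_powr' Fq B_def ennreal_leI)
      qed
      show "AE w in circle_measure. (\<integral>\<^sup>+x. norm (F (x, w)) powr p \<partial>T) \<le>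
          ennreal (A' * exp (\<integral>x. ln (norm (F (x, w)) powr p) \<partial>T))"
      proof (rule AE_I2)
        fix w
        define cw where "cw = (\<lambda>\<alpha>. c \<alpha> * w ^ Poly_Mapping.lookup \<alpha> n)"
        have Fw: "F (x, w) = monomial_sum A cw n x" for x
          by (simp add: F_def f_def cw_def monomial_sum_upd)
        have int_w: "integrable T (\<lambda>x. norm (F (x, w)) powr p)"
          unfolding Fw T_def by (rule integrable_monomial_sum_powr[OF p])
        show "(\<integral>\<^sup>+x. norm (F (x, w)) powr p \<partial>T) \<le> ennreal (A' * exp (\<integral>x. ln (norm (F (x, w)) powr p) \<partial>T))"
          using IH[of cw]
        proof
          \<comment> \<open>An exceptional slice: the left-hand side is 0, so the bound is trivial
            whatever value the logarithmic integral has.\<close>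
          assume "AE z in T. monomial_sum A cw n z = 0"
          then have "(\<integral>\<^sup>+x. norm (F (x, w)) powr p \<partial>T) = (\<integral>\<^sup>+x. 0 \<partial>T)"
            by (intro nn_integral_cong_AE) (auto simp: Fw elim!: eventually_mono)
          then show ?thesis by simp
        next
          assume "Lp_mahler_ineq (\<Prod>j<n. Lambda_const p (D j) powr p) p n (monomial_sum A cw n)"
          then have "(\<integral>x. norm (F (x, w)) powr p \<partial>T) \<le> A' * exp (p * (\<integral>x. ln (norm (F (x, w))) \<partial>T))"
            by (simp add: Lp_mahler_ineq_def Fw T_def A'_def)
          then show ?thesis
            using int_w by (simp add: nn_integral_eq_integral ln_powr' ennreal_leI)
        qed
      qed
    qed (use AB T.prob_space_axioms circle.prob_space_axioms in auto)
    then have "(\<integral>z. norm (F z) powr p \<partial>(T \<Otimes>\<^sub>M circle_measure)) \<le>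
        A' * B * exp (p * (\<integral>z. ln (norm (F z)) \<partial>(T \<Otimes>\<^sub>M circle_measure)))"
      using intF AB by (simp add: nn_integral_eq_integral ln_powr' ennreal_le_iff)
    then have "Lp_mahler_ineq (A' * B) p (Suc n) f"
      using AE_transfer[of "\<lambda>y. y \<noteq> 0"] nz int
        integral_transfer[of "\<lambda>y. norm y powr p"] integral_transfer[of "\<lambda>y. ln (norm y)"]
        integrable_transfer[of "\<lambda>y. ln (norm y)"]
      by (simp add: Lp_mahler_ineq_def)
    then show ?thesis
      by (simp add: A'_def B_def f_def)
  qed
qed

section \<open>The inequality for polynomials\<close>

lemma poly_eval_eq_monomial_sum:
  "poly_eval n P = monomial_sum (Poly_Mapping.keys P) (Poly_Mapping.lookup P) n"
  by (simp add: poly_eval_def monomial_sum_def fun_eq_iff)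

lemma lookup_le_degree_in: "\<alpha> \<in> Poly_Mapping.keys P \<Longrightarrow> Poly_Mapping.lookup \<alpha> j \<le> degree_in j P"
  unfolding degree_in_def by (intro Max_ge) auto

lemma mahler_measure_nonneg: "0 \<le> mahler_measure n P"
  by (simp add: mahler_measure_def)

lemma torus_Lp_norm_le:
  assumes p: "p > 0"
  shows "torus_Lp_norm n p P \<le> (\<Prod>j<n. Lambda_const p (degree_in j P)) * mahler_measure n P"
    (is "_ \<le> ?K * _")
proof -
  have K: "0 \<le> ?K" by (auto intro: prod_nonneg)
  have "(AE z in torus_measure n. poly_eval n P z = 0) \<or>
      Lp_mahler_ineq (\<Prod>j<n. Lambda_const p (degree_in j P) powr p) p n (poly_eval n P)"
    unfolding poly_eval_eq_monomial_sum
    by (rule Lp_mahler_monomial_sum) (auto simp: p lookup_le_degree_in)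
  then consider "AE z in torus_measure n. poly_eval n P z = 0"
    | "P \<noteq> 0" "Lp_mahler_ineq (\<Prod>j<n. Lambda_const p (degree_in j P) powr p) p n (poly_eval n P)"
    by (cases "P = 0") auto
  then show ?thesis
  proof cases
    \<comment> \<open>The norm is 0 and the right-hand side is nonnegative; this includes the zero
      polynomial.\<close>
    case 1
    then have "(\<integral>z. norm (poly_eval n P z) powr p \<partial>torus_measure n) = 0"
      by (intro integral_eq_zero_AE) (auto elim!: eventually_mono)
    then show ?thesis
      using K mahler_measure_nonneg by (simp add: torus_Lp_norm_def)
  next
    case 2
    define E where "E = exp (\<integral>z. ln (norm (poly_eval n P z)) \<partial>torus_measure n)"
    have "(\<integral>z. norm (poly_eval n P z) powr p \<partial>torus_measure n) \<le> (\<Prod>j<n. Lambda_const p (degree_in j P) powr p) * E powr p"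
      using 2 by (simp add: Lp_mahler_ineq_def E_def powr_def)
    also have "\<dots> = (?K * E) powr p"
      using K by (simp add: powr_mult prod_powr_distrib E_def)
    finally have "torus_Lp_norm n p P \<le> ((?K * E) powr p) powr (1 / p)"
      unfolding torus_Lp_norm_def using p by (intro powr_mono2) (auto intro: integral_nonneg_AE)
    also have "\<dots> = ?K * E"
      using p K by (simp add: powr_powr E_def)
    finally show ?thesis
      using 2 by (simp add: mahler_measure_def E_def)
  qed
qed

section \<open>The extremal polynomials\<close>

lemma integral_torus_component:
  fixes f :: "complex \<Rightarrow> real"
  assumes f: "f \<in> borel_measurable circle_measure" and j: "j < n"
  shows "(\<integral>z. f (z j) \<partial>torus_measure n) = (\<integral>w. f w \<partial>circle_measure)"
    and "integrable (torus_measure n) (\<lambda>z. f (z j)) \<longleftrightarrow> integrable circle_measure f"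
proof -
  have d: "distr (torus_measure n) circle_measure (\<lambda>z. z j) = circle_measure"
    unfolding torus_measure_def using j by (intro distr_PiM_component prob_space_circle_measure) auto
  have m: "(\<lambda>z. z j) \<in> torus_measure n \<rightarrow>\<^sub>M circle_measure"
    unfolding torus_measure_def using j by (intro measurable_component_singleton) auto
  show "(\<integral>z. f (z j) \<partial>torus_measure n) = (\<integral>w. f w \<partial>circle_measure)"
    using integral_distr[OF m f] d by simp
  show "integrable (torus_measure n) (\<lambda>z. f (z j)) \<longleftrightarrow> integrable circle_measure f"
    using integrable_distr_eq[OF m f] d by simp
qed

lemma torus_Lp_norm_extremal:
  assumes p: "p > 0" and d: "\<And>j. j < n \<Longrightarrow> d j \<ge> 1"
  shows "torus_Lp_norm n p (\<Prod>j<n. (1 + poly_var j) ^ d j) = (\<Prod>j<n. Lambda_const p (d j))"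
proof -
  interpret product_sigma_finite "\<lambda>_::nat. circle_measure"
    by unfold_locales
  have "(\<integral>z. norm (\<Prod>j<n. (1 + z j) ^ d j) powr p \<partial>torus_measure n) =
      (\<integral>z. (\<Prod>j<n. norm (1 + z j) powr (real (d j) * p)) \<partial>torus_measure n)"
  proof (intro Bochner_Integration.integral_cong refl)
    fix z :: "nat \<Rightarrow> complex"
    \<comment> \<open>At \<open>z j = -1\<close> this relies on \<open>d j\<close> being positive:
      for exponent 0 the left side would be 1 and the right side
      \<open>0 powr 0 = 0\<close>.\<close>
    have "norm ((1 + z j) ^ d j) powr p = norm (1 + z j) powr (real (d j) * p)" if "j < n" for j
      using d[OF that] by (simp add: norm_power powr_realpow' powr_powr[symmetric])
    then show "norm (\<Prod>j<n. (1 + z j) ^ d j) powr p = (\<Prod>j<n. norm (1 + z j) powr (real (d j) * p))"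
      by (simp add: prod_powr_distrib flip: prod_norm)
  qed
  also have "\<dots> = (\<Prod>j<n. \<integral>w. norm (1 + w) powr (real (d j) * p) \<partial>circle_measure)"
    unfolding torus_measure_def
  proof (rule product_integral_prod)
    fix j assume "j \<in> {..<n}"
    then have "0 < real (d j) * p" using d[of j] p by simp
    then show "integrable circle_measure (\<lambda>w. norm (1 + w) powr (real (d j) * p))"
      by (intro integrable_circle_continuous continuous_intros)
  qed simp
  finally show ?thesis
    unfolding torus_Lp_norm_def poly_eval_extremal Lambda_const_def
    by (simp add: prod_powr_distrib integral_nonneg_AE)
qed

lemma mahler_measure_extremal:
  "mahler_measure n (\<Prod>j<n. (1 + poly_var j) ^ d j) = 1"
proof -
  \<comment> \<open>The value at the origin is 1, so the polynomial is nonzero and the exponential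
    branch of the Mahler measure applies.\<close>
  have "poly_eval n (\<Prod>j<n. (1 + poly_var j) ^ d j) (\<lambda>_. 0) \<noteq> 0"
    by (simp add: poly_eval_extremal)
  then have nz: "(\<Prod>j<n. (1 + poly_var j) ^ d j) \<noteq> (0 :: cpoly)"
    by (metis poly_eval_zero)
  have l: "(\<lambda>w. ln (norm (1 + w))) \<in> borel_measurable circle_measure"
    by (intro borel_measurable_circle) measurable
  have "AE z in torus_measure n. 1 + z j \<noteq> 0" if "j < n" for j
    unfolding torus_measure_def
    using that AE_circle_neq[of "-1"]
    by (intro AE_PiM_component[where P = "\<lambda>w. 1 + w \<noteq> 0"] prob_space_circle_measure)
      (auto simp: add_eq_0_iff elim!: eventually_mono)
  then have ne: "AE z in torus_measure n. \<forall>j\<in>{..<n}. 1 + z j \<noteq> 0"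
    by (intro AE_finite_allI) auto
  \<comment> \<open>Each coordinate has the circle measure as its marginal, so this is the vanishing
    logarithmic mean of a linear factor, with \<open>b = -1\<close>.\<close>
  have comp: "has_bochner_integral (torus_measure n) (\<lambda>z. ln (norm (1 + z j))) 0" if "j < n" for j
    using integral_torus_component[OF l that] integrable_ln_one_minus[of "-1"] integral_ln_one_minus[of "-1"]
    by (simp add: has_bochner_integral_iff)
  have "(\<integral>z. ln (norm (\<Prod>j<n. (1 + z j) ^ d j)) \<partial>torus_measure n) =
      (\<integral>z. (\<Sum>j<n. real (d j) * ln (norm (1 + z j))) \<partial>torus_measure n)"
  proof (rule integral_cong_AE)
    show "AE z in torus_measure n. ln (norm (\<Prod>j<n. (1 + z j) ^ d j)) = (\<Sum>j<n. real (d j) * ln (norm (1 + z j)))"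
      using ne
    proof eventually_elim
      case (elim z)
      then show ?case
        by (simp add: norm_power flip: prod_norm, subst ln_prod) (auto simp: ln_realpow)
    qed
  qed (use measurable_torus_component[measurable] in measurable)
  also have "\<dots> = (\<Sum>j<n. real (d j) * (\<integral>z. ln (norm (1 + z j)) \<partial>torus_measure n))"
    using comp by (subst Bochner_Integration.integral_sum) (auto simp: has_bochner_integral_iff)
  also have "\<dots> = 0"
    using comp by (simp add: has_bochner_integral_iff)
  finally show ?thesis
    using nz by (simp add: mahler_measure_def poly_eval_extremal)
qed

theorem theorem3p1:
  fixes n :: nat and p :: real
  assumes "n \<ge> 1" and "p > 0"
  shows "(\<forall>P\<in>polys n.
            torus_Lp_norm n p P \<le> (\<Prod>j<n. Lambda_const p (degree_in j P)) * mahler_measure n P) \<and>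
         (\<forall>d :: nat \<Rightarrow> nat. (\<forall>j<n. d j \<ge> 1) \<longrightarrow>
            (let P = (\<Prod>j<n. (1 + poly_var j) ^ d j) in
               torus_Lp_norm n p P = (\<Prod>j<n. Lambda_const p (d j)) \<and> mahler_measure n P = 1))"
  using assms by (auto simp: Let_def torus_Lp_norm_le torus_Lp_norm_extremal mahler_measure_extremal)

end
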